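(* Let $K\subset\mathbb{R}^n$ be a nonempty semi-algebraic set and let $F_l=(F_{l1},\dots,F_{ln}):K\to\mathbb{R}^n$, $l=1,\dots,m$, be maps all of whose components $F_{lj}$ are (restrictions to $K$ of) polynomials in $x_1,\dots,x_n$ with real coefficients. Then both the weak Pareto solution set $\mathrm{Sol}^w(\mathrm{PVVI})$ and the Pareto solution set $\mathrm{Sol}(\mathrm{PVVI})$ of the polynomial vector variational inequality defined by $F=(F_1,\dots,F_m)$ and $K$ are semi-algebraic subsets of $\mathbb{R}^n$. Consequently, each of them has finitely many connected components and every connected component is path connected.
   Context: A set in $\mathbb{R}^n$ is semi-algebraic if it is a finite union of sets of the form $\{x\in\mathbb{R}^n: f_1(x)=\dots=f_\ell(x)=0,\ g_{\ell+1}(x)<0,\dots,g_p(x)<0\}$ with all $f_i,g_j$ in $\mathbb{R}[x_1,\dots,x_n]$. For $x\in K$ and $u\in\mathbb{R}^n$ put $F(x)(u)=(\langle F_1(x),u\rangle,\dots,\langle F_m(x),u\rangle)\in\mathbb{R}^m$, where $\langle\cdot,\cdot\rangle$ is the standard scalar product. Let $C=\mathbb{R}^m_+$ be the nonnegative orthant and $\mathrm{int}\,C$ its interior. The Pareto solution set is $$\mathrm{Sol}(\mathrm{PVVI})=\{x\in K:\ -F(x)(y-x)\notin C\setminus\{0\}\ \text{ for all } y\in K\},$$ and the weak Pareto solution set is $$\mathrm{Sol}^w(\mathrm{PVVI})=\{x\in K:\ -F(x)(y-x)\notin \mathrm{int}\,C\ \text{ for all } y\in K\}.$$ Connected components and path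 connectedness are with respect to the topology induced from $\mathbb{R}^n$. No closedness, convexity or constraint qualification on $K$ is assumed. *)

theory Defs
  imports "HOL-Analysis.Analysis"
begin

text \<open>
  Elements of \<open>\<real>[x\<^sub>1,\<dots>,x\<^sub>n]\<close> are represented by the functions they induce on \<open>\<real>\<^sup>n\<close>. The library
  predicate \<^const>\<open>real_polynomial_function\<close> is generated from constants and bounded linear
  functionals by addition and multiplication; every linear functional on \<open>\<real>\<^sup>n\<close> is bounded and is a
  linear combination of the coordinates, so on \<open>real ^ 'n\<close> these are exactly the polynomial
  functions in the coordinates.
\<close>

definition basic_semialgebraic :: "(real ^ 'n) set \<Rightarrow> bool" where
  "basic_semialgebraic S \<longleftrightarrow>
    (\<exists>E G. finite E \<and> finite G \<and>
       (\<forall>f\<in>E. real_polynomial_function f) \<and> (\<forall>g\<in>G. real_polynomial_function g) \<and>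
       S = {x. (\<forall>f\<in>E. f x = 0) \<and> (\<forall>g\<in>G. g x < 0)})"

definition semialgebraic :: "(real ^ 'n) set \<Rightarrow> bool" where
  "semialgebraic S \<longleftrightarrow> (\<exists>\<B>. finite \<B> \<and> (\<forall>B\<in>\<B>. basic_semialgebraic B) \<and> S = \<Union>\<B>)"

definition polynomial_map_on :: "(real ^ 'n) set \<Rightarrow> (real ^ 'n \<Rightarrow> real ^ 'n) \<Rightarrow> bool" where
  "polynomial_map_on K f \<longleftrightarrow>
    (\<forall>j. \<exists>p. real_polynomial_function p \<and> (\<forall>x\<in>K. f x $ j = p x))"

definition nonneg_orthant :: "(real ^ 'm) set" where
  "nonneg_orthant = {v. \<forall>l. 0 \<le> v $ l}"

definition vvi_map :: "('m::finite \<Rightarrow> real ^ 'n \<Rightarrow> real ^ 'n) \<Rightarrow> real ^ 'n \<Rightarrow> real ^ 'n \<Rightarrow> real ^ 'm" where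
  "vvi_map F x u = (\<chi> l. F l x \<bullet> u)"

definition Sol_PVVI :: "('m::finite \<Rightarrow> real ^ 'n \<Rightarrow> real ^ 'n) \<Rightarrow> (real ^ 'n) set \<Rightarrow> (real ^ 'n) set" where
  "Sol_PVVI F K = {x \<in> K. \<forall>y\<in>K. - vvi_map F x (y - x) \<notin> nonneg_orthant - {0}}"

definition Solw_PVVI :: "('m::finite \<Rightarrow> real ^ 'n \<Rightarrow> real ^ 'n) \<Rightarrow> (real ^ 'n) set \<Rightarrow> (real ^ 'n) set" where
  "Solw_PVVI F K = {x \<in> K. \<forall>y\<in>K. - vvi_map F x (y - x) \<notin> interior nonneg_orthant}"

end

theory Submission
  imports Defs
begin

text \<open>
  The two solution sets are described by first-order formulas over the reals: a point \<open>x\<close> of \<open>K\<close> fails to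
  be a weak solution if some \<open>y\<close> in \<open>K\<close> makes every polynomial \<open>F\<^sub>l(x) \<bullet> (y - x)\<close> negative, and fails to
  be a Pareto solution if some \<open>y\<close> in \<open>K\<close> makes all of them nonpositive and one of them negative. By the
  Tarski--Seidenberg theorem such sets are semi-algebraic. The statements on components hold
  for every semi-algebraic set. Both theorems are derived from one fact about polynomials in one
  variable \<open>t\<close> whose coefficients depend on a parameter \<open>x\<close>.

  That fact (\<open>sign_iso_of_same_signs\<close>) is a form of the Cohen--Hoermander elimination method. For
  finitely many such polynomials there are finitely many polynomials \<open>b\<close> in the coefficients with the
  following property: if every \<open>b\<close> has the same sign at two parameters \<open>x\<close> and \<open>y\<close>, then an increasing
  bijection of the line carries the sign pattern of the polynomials at \<open>x\<close> to their sign pattern at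
  \<open>y\<close>. Describing a sign pattern by such a bijection avoids any explicit table of signs. A polynomial
  of largest degree is added last: between two consecutive roots of the other polynomials, its
  derivative among them, it is strictly monotone, and its sign at these roots equals that of its
  pseudo-remainders (where leading coefficients vanish, polynomials are shortened instead). Hence the places where it has a root are already determined.

  Semi-algebraic sets are treated as sets that are determined by the signs of finitely many
  polynomials. In this form closure under Boolean operations is immediate. Closure under projection
  (\<open>sign_determined_projection\<close>) holds because the bijection carries a point over \<open>x\<close> to a point over \<open>y\<close>
  with the same signs.

  If the family is closed under differentiation, then every root is a simple root of some member and
  so persists under small changes of the parameter. As the number of roots is constant as long as
  the signs of the polynomials \<open>b\<close> are, the roots are continuous there. The space over a
  path-connected set of such parameters is therefore cut into graphs and bands, which are path
  connected. By induction on the dimension every semi-algebraic set is a finite union of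
  path-connected sets (\<open>sign_determined_finitely_path_connected\<close>).

  A finite union of path-connected sets may have components that are not path connected, as the
  closed topologist's sine curve shows. But a semi-algebraic set \<open>S\<close> meets every ball in a semi-algebraic
  set. If \<open>x\<close> in \<open>S\<close> is a limit of a path component \<open>P\<close> of \<open>S\<close>, then in each ball around \<open>x\<close> one of the finitely
  many pieces of \<open>P\<close> still accumulates at \<open>x\<close>. Joining points of nested pieces by paths in shrinking
  balls gives a path from \<open>P\<close> to \<open>x\<close>. So path components are closed in \<open>S\<close>; as there are finitely many of
  them, they are the connected components (\<open>components_finite_path_connected\<close>).
\<close>

section \<open>Order automorphisms of the line\<close>

definition order_iso :: "(real \<Rightarrow> real) \<Rightarrow> bool" where
  "order_iso h \<longleftrightarrow> strict_mono h \<and> surj h"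

lemma order_iso_id: "order_iso (\<lambda>t. t)"
  by (simp add: order_iso_def strict_mono_def)

lemma order_iso_comp: "order_iso g \<Longrightarrow> order_iso h \<Longrightarrow> order_iso (\<lambda>t. g (h t))"
  unfolding order_iso_def using comp_surj[of h g] by (auto simp: strict_mono_def o_def)

lemma order_iso_less: "order_iso h \<Longrightarrow> h s < h t \<longleftrightarrow> s < t"
  by (simp add: order_iso_def strict_mono_less)

lemma order_iso_le: "order_iso h \<Longrightarrow> h s \<le> h t \<longleftrightarrow> s \<le> t"
  by (simp add: order_iso_def strict_mono_less_eq)

lemma order_iso_eq: "order_iso h \<Longrightarrow> h s = h t \<longleftrightarrow> s = t"
  by (simp add: order_iso_def strict_mono_eq)

lemma order_iso_continuous: "order_iso h \<Longrightarrow> continuous_on A h"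
  by (rule continuous_on_subset[of UNIV], rule continuous_onI_mono)
     (auto simp: order_iso_def strict_mono_less_eq)

text \<open>
  The bijection is piecewise linear on \<open>[a, c]\<close> and \<open>[c, b]\<close>; the map with \<open>c\<close> and \<open>c'\<close> exchanged is its
  inverse.
\<close>
lemma order_iso_move_point:
  fixes a b c c' :: real
  assumes "a < c" "c < b" "a < c'" "c' < b"
  shows "\<exists>\<phi>. order_iso \<phi> \<and> \<phi> c = c' \<and> (\<forall>t. t \<le> a \<or> b \<le> t \<longrightarrow> \<phi> t = t)"
proof -
  define \<phi> where "\<phi> = (\<lambda>c c' t. if t \<le> a \<or> b \<le> t then t
      else if t \<le> c then a + (t - a) * ((c' - a) / (c - a))
      else b - (b - t) * ((b - c') / (b - c)))"
  have lower: "a < \<phi> c c' t \<and> \<phi> c c' t \<le> c'" if "a < t" "t \<le> c" "a < c" "c < b" "a < c'" for c c' t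
  proof -
    have "0 < (t - a) * ((c' - a) / (c - a))" using that by simp
    moreover have "(t - a) * ((c' - a) / (c - a)) \<le> (c - a) * ((c' - a) / (c - a))"
      using that by (intro mult_right_mono) auto
    ultimately show ?thesis using that by (simp add: \<phi>_def)
  qed
  have upper: "c' < \<phi> c c' t \<and> \<phi> c c' t < b" if "c < t" "t < b" "a < c" "c < b" "c' < b" for c c' t
  proof -
    have "0 < (b - t) * ((b - c') / (b - c))" using that by simp
    moreover have "(b - t) * ((b - c') / (b - c)) < (b - c) * ((b - c') / (b - c))"
      using that by (intro mult_strict_right_mono) auto
    ultimately show ?thesis using that by (simp add: \<phi>_def)
  qed
  have inv: "\<phi> c c' (\<phi> c' c t) = t" if "a < c" "c < b" "a < c'" "c' < b" for c c' t
  proof -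
    consider "t \<le> a \<or> b \<le> t" | "a < t" "t \<le> c'" | "c' < t" "t < b" by linarith
    then show ?thesis
    proof cases
      case 1 then show ?thesis by (simp add: \<phi>_def)
    next
      case 2
      have "\<phi> c c' (\<phi> c' c t) = a + (\<phi> c' c t - a) * ((c' - a) / (c - a))"
        using lower[OF 2 that(3,4,1)] that by (simp add: \<phi>_def)
      moreover have "\<phi> c' c t = a + (t - a) * ((c - a) / (c' - a))"
        using 2 that by (simp add: \<phi>_def)
      ultimately have "\<phi> c c' (\<phi> c' c t) = a + (t - a) * ((c - a) / (c' - a)) * ((c' - a) / (c - a))"
        by simp
      then show ?thesis using that by simp
    next
      case 3
      have "\<phi> c c' (\<phi> c' c t) = b - (b - \<phi> c' c t) * ((b - c') / (b - c))"
        using upper[OF 3 that(3,4,2)] that by (simp add: \<phi>_def)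
      moreover have "\<phi> c' c t = b - (b - t) * ((b - c) / (b - c'))"
        using 3 that by (simp add: \<phi>_def)
      ultimately have "\<phi> c c' (\<phi> c' c t) = b - (b - t) * ((b - c) / (b - c')) * ((b - c') / (b - c))"
        by simp
      then show ?thesis using that by simp
    qed
  qed
  have "strict_mono (\<phi> c c')"
  proof (rule strict_monoI)
    fix s t :: real assume "s < t"
    have l: "s < t \<Longrightarrow> s * ((c' - a) / (c - a)) < t * ((c' - a) / (c - a))" for s t
      using assms by (intro mult_strict_right_mono) auto
    have u: "s < t \<Longrightarrow> s * ((b - c') / (b - c)) < t * ((b - c') / (b - c))" for s t
      using assms by (intro mult_strict_right_mono) auto
    consider "t \<le> a" | "b \<le> s" | "s \<le> a" "a < t" | "s < b" "b \<le> t"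
      | "a < s" "t \<le> c" | "a < s" "s \<le> c" "c < t" "t < b" | "c < s" "t < b"
      using \<open>s < t\<close> assms by linarith
    then show "\<phi> c c' s < \<phi> c c' t"
    proof cases
      case 3
      then have "\<phi> c c' s = s" by (simp add: \<phi>_def)
      moreover have "a < \<phi> c c' t"
      proof (cases "t < b")
        case True
        then show ?thesis
          using lower[of t c c'] upper[of c t c'] 3 assms by (cases "t \<le> c") auto
      qed (use 3 assms in \<open>simp add: \<phi>_def\<close>)
      ultimately show ?thesis using 3 by linarith
    next
      case 4
      then have "\<phi> c c' t = t" by (simp add: \<phi>_def)
      moreover have "\<phi> c c' s < b"
      proof (cases "a < s")
        case True
        then show ?thesis
          using lower[of s c c'] upper[of c s c'] 4 assms by (cases "s \<le> c") auto
      qed (use 4 assms in \<open>simp add: \<phi>_def\<close>)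
      ultimately show ?thesis using 4 by linarith
    next
      case 5 then show ?thesis using l[of "s - a" "t - a"] \<open>s < t\<close> assms by (auto simp: \<phi>_def)
    next
      case 6 then show ?thesis using lower[of s c c'] upper[of c t c'] assms by auto
    next
      case 7 then show ?thesis using u[of "b - t" "b - s"] \<open>s < t\<close> assms by (auto simp: \<phi>_def)
    qed (use \<open>s < t\<close> in \<open>auto simp: \<phi>_def\<close>)
  qed
  moreover have "surj (\<phi> c c')"
    using inv[OF assms] by (rule surjI)
  moreover have "\<phi> c c' c = c'" using assms by (simp add: \<phi>_def)
  moreover have "\<forall>t. t \<le> a \<or> b \<le> t \<longrightarrow> \<phi> c c' t = t" by (simp add: \<phi>_def)
  ultimately show ?thesis unfolding order_iso_def by blast
qed

text \<open>
  The signs at the end points decide whether \<open>q\<close> and \<open>r\<close> vanish inside the interval. If they do, each has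
  one zero there, and it suffices to move the zero of \<open>q\<close> to that of \<open>r\<close>; otherwise the signs agree already.
\<close>
lemma match_signs_increasing:
  fixes q r :: "real \<Rightarrow> real"
  assumes "a < b" and cq: "continuous_on {a..b} q" and cr: "continuous_on {a..b} r"
    and mq: "strict_mono_on {a..b} q" and mr: "strict_mono_on {a..b} r"
    and sa: "sgn (q a) = sgn (r a)" and sb: "sgn (q b) = sgn (r b)"
  shows "\<exists>\<phi>. order_iso \<phi> \<and> (\<forall>t. t \<le> a \<or> b \<le> t \<longrightarrow> \<phi> t = t) \<and>
    (\<forall>t\<in>{a..b}. sgn (q t) = sgn (r (\<phi> t)))"
proof (cases "q a < 0 \<and> 0 < q b")
  case True
  then have r: "r a < 0" "0 < r b" using sa sb by (auto simp: sgn_if split: if_splits)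
  obtain c where c: "a \<le> c" "c \<le> b" "q c = 0"
    using IVT'[of q a 0 b] True cq \<open>a < b\<close> by auto
  obtain c' where c': "a \<le> c'" "c' \<le> b" "r c' = 0"
    using IVT'[of r a 0 b] r cr \<open>a < b\<close> by auto
  have lt: "a < c" "c < b" "a < c'" "c' < b"
    using c c' True r by (auto simp: less_le)
  obtain \<phi> where \<phi>: "order_iso \<phi>" "\<phi> c = c'" "\<And>t. t \<le> a \<or> b \<le> t \<Longrightarrow> \<phi> t = t"
    using order_iso_move_point[OF lt] by blast
  have "sgn (q t) = sgn (r (\<phi> t))" if t: "t \<in> {a..b}" for t
  proof -
    have \<phi>t: "\<phi> t \<in> {a..b}"
      using t order_iso_le[OF \<phi>(1), of a t] order_iso_le[OF \<phi>(1), of t b] \<phi>(3)[of a] \<phi>(3)[of b] by auto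
    consider "t < c" | "t = c" | "c < t" by linarith
    then show ?thesis
    proof cases
      case 1
      then have "\<phi> t < c'" using order_iso_less[OF \<phi>(1), of t c] \<phi>(2) by simp
      then show ?thesis
        using strict_mono_onD[OF mq _ _ 1] strict_mono_onD[OF mr, of "\<phi> t" c'] c c' t \<phi>t by auto
    next
      case 2 then show ?thesis using c c' \<phi> by simp
    next
      case 3
      then have "c' < \<phi> t" using order_iso_less[OF \<phi>(1), of c t] \<phi>(2) by simp
      then show ?thesis
        using strict_mono_onD[OF mq _ _ 3] strict_mono_onD[OF mr, of c' "\<phi> t"] c c' t \<phi>t by auto
    qed
  qed
  then show ?thesis using \<phi> by blast
next
  case False
  have "sgn (q t) = sgn (r t)" if t: "t \<in> {a..b}" for t
  proof (cases "t = a \<or> t = b")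
    case True then show ?thesis using sa sb by auto
  next
    case f: False
    then have "q a < q t" "q t < q b" "r a < r t" "r t < r b"
      using t strict_mono_onD[OF mq, of a t] strict_mono_onD[OF mq, of t b]
        strict_mono_onD[OF mr, of a t] strict_mono_onD[OF mr, of t b] by auto
    then show ?thesis using False sa sb by (auto simp: sgn_if split: if_splits)
  qed
  then show ?thesis using order_iso_id by blast
qed

definition comonotone_on :: "real set \<Rightarrow> (real \<Rightarrow> real) \<Rightarrow> (real \<Rightarrow> real) \<Rightarrow> bool" where
  "comonotone_on A q r \<longleftrightarrow>
    strict_mono_on A q \<and> strict_mono_on A r \<or>
    strict_mono_on A (\<lambda>t. - q t) \<and> strict_mono_on A (\<lambda>t. - r t)"

lemma match_signs_comonotone:
  fixes q r :: "real \<Rightarrow> real"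
  assumes "a < b" and cq: "continuous_on {a..b} q" and cr: "continuous_on {a..b} r"
    and m: "comonotone_on {a..b} q r"
    and sa: "sgn (q a) = sgn (r a)" and sb: "sgn (q b) = sgn (r b)"
  shows "\<exists>\<phi>. order_iso \<phi> \<and> (\<forall>t. t \<le> a \<or> b \<le> t \<longrightarrow> \<phi> t = t) \<and>
    (\<forall>t\<in>{a..b}. sgn (q t) = sgn (r (\<phi> t)))"
  using m unfolding comonotone_on_def
proof
  assume "strict_mono_on {a..b} q \<and> strict_mono_on {a..b} r"
  then show ?thesis using match_signs_increasing[OF assms(1-3) _ _ sa sb] by blast
next
  assume "strict_mono_on {a..b} (\<lambda>t. - q t) \<and> strict_mono_on {a..b} (\<lambda>t. - r t)"
  then show ?thesis
    using match_signs_increasing[of a b "\<lambda>t. - q t" "\<lambda>t. - r t"] assms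
    by (auto simp: sgn_minus intro!: continuous_on_minus)
qed

text \<open>
  The bijections of the gaps between neighbouring points of \<open>Z\<close> are composed. Each of them is the
  identity outside its gap, so they do not interfere.
\<close>
lemma match_signs_finite:
  fixes q r :: "real \<Rightarrow> real"
  assumes "finite Z" "Z \<noteq> {}" and cq: "continuous_on UNIV q" and cr: "continuous_on UNIV r"
    and "\<And>z. z \<in> Z \<Longrightarrow> sgn (q z) = sgn (r z)"
    and "\<And>a b. a \<in> Z \<Longrightarrow> b \<in> Z \<Longrightarrow> a < b \<Longrightarrow> Z \<inter> {a<..<b} = {} \<Longrightarrow> comonotone_on {a..b} q r"
  shows "\<exists>\<phi>. order_iso \<phi> \<and> (\<forall>t\<in>Z. \<phi> t = t) \<and> (\<forall>t. t < Min Z \<or> Max Z < t \<longrightarrow> \<phi> t = t) \<and>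
    (\<forall>t\<in>{Min Z..Max Z}. sgn (q t) = sgn (r (\<phi> t)))"
  using assms(1,2,5,6)
proof (induction Z rule: finite_linorder_max_induct)
  case empty
  then show ?case by simp
next
  case (insert b Z)
  show ?case
  proof (cases "Z = {}")
    case True
    then show ?thesis using insert.prems(2) order_iso_id by auto
  next
    case False
    define a where "a = Max Z"
    have a: "a \<in> Z" "a < b" using False insert.hyps by (auto simp: a_def)
    have aZ: "z \<le> a" if "z \<in> Z" for z using that insert.hyps by (simp add: a_def)
    have minmax: "Min (insert b Z) = Min Z" "Max (insert b Z) = b" "Min Z \<le> a"
    proof -
      have "Min Z \<le> a" "Min Z < b" using False insert.hyps a by auto
      then show "Min (insert b Z) = Min Z" "Max (insert b Z) = b" "Min Z \<le> a"
        using False insert.hyps(1) a(2) by (simp_all add: a_def)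
    qed
    obtain \<phi> where \<phi>: "order_iso \<phi>" "\<And>t. t \<in> Z \<Longrightarrow> \<phi> t = t"
        "\<And>t. t < Min Z \<or> a < t \<Longrightarrow> \<phi> t = t"
        "\<And>t. t \<in> {Min Z..a} \<Longrightarrow> sgn (q t) = sgn (r (\<phi> t))"
    proof -
      have "comonotone_on {c..d} q r"
        if "c \<in> Z" "d \<in> Z" "c < d" "Z \<inter> {c<..<d} = {}" for c d
        using that insert.hyps(2) by (intro insert.prems(3)) (auto dest: less_asym)
      with insert.IH[OF False] insert.prems(2)
      have "\<exists>\<phi>. order_iso \<phi> \<and> (\<forall>t\<in>Z. \<phi> t = t) \<and> (\<forall>t. t < Min Z \<or> Max Z < t \<longrightarrow> \<phi> t = t) \<and>
          (\<forall>t\<in>{Min Z..Max Z}. sgn (q t) = sgn (r (\<phi> t)))" by simp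
      then show ?thesis using that a_def by metis
    qed
    have "comonotone_on {a..b} q r"
      using a aZ by (intro insert.prems(3)) force+
    then have "\<exists>\<psi>. order_iso \<psi> \<and> (\<forall>t. t \<le> a \<or> b \<le> t \<longrightarrow> \<psi> t = t) \<and>
        (\<forall>t\<in>{a..b}. sgn (q t) = sgn (r (\<psi> t)))"
      using insert.prems(2) a
      by (intro match_signs_comonotone continuous_on_subset[OF cq] continuous_on_subset[OF cr]) auto
    then obtain \<psi> where \<psi>: "order_iso \<psi>" "\<And>t. t \<le> a \<or> b \<le> t \<Longrightarrow> \<psi> t = t"
        "\<And>t. t \<in> {a..b} \<Longrightarrow> sgn (q t) = sgn (r (\<psi> t))"
      by blast
    have \<psi>a: "a \<le> \<psi> t" if "a \<le> t" for t
      using order_iso_le[OF \<psi>(1), of a t] \<psi>(2)[of a] that by simp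
    have \<phi>a: "\<phi> t = t" if "a \<le> t" for t
      using \<phi>(2)[OF a(1)] \<phi>(3)[of t] that by (cases "t = a") auto
    show ?thesis
    proof (intro exI[of _ "\<lambda>t. \<phi> (\<psi> t)"] conjI ballI allI impI)
      show "order_iso (\<lambda>t. \<phi> (\<psi> t))" using \<phi>(1) \<psi>(1) by (rule order_iso_comp)
    next
      fix t assume "t \<in> insert b Z"
      then show "\<phi> (\<psi> t) = t" using \<phi>a \<psi>(2) \<phi>(2) a aZ by fastforce
    next
      fix t assume "t < Min (insert b Z) \<or> Max (insert b Z) < t"
      then show "\<phi> (\<psi> t) = t" using \<phi>(3) \<psi>(2) minmax a(2) by fastforce
    next
      fix t assume t: "t \<in> {Min (insert b Z)..Max (insert b Z)}"
      show "sgn (q t) = sgn (r (\<phi> (\<psi> t)))"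
      proof (cases "t \<le> a")
        case True then show ?thesis using t minmax \<psi>(2) \<phi>(4) by auto
      next
        case False then show ?thesis using t minmax \<psi>(3)[of t] \<psi>a[of t] \<phi>a by auto
      qed
    qed
  qed
qed

section \<open>Adding one polynomial to a matched sign pattern\<close>

lemma poly_sgn_at_top:
  fixes p :: "real poly"
  shows "\<exists>M. \<forall>t\<ge>M. sgn (poly p t) = sgn (lead_coeff p)"
proof -
  consider "p = 0" | "0 < lead_coeff p" | "0 < lead_coeff (- p)"
    by (metis lead_coeff_minus leading_coeff_0_iff linorder_neqE_linordered_idom neg_0_less_iff_less)
  then show ?thesis
  proof cases
    case 2 then show ?thesis using poly_pinfty_gt_lc[of p] by (force simp: sgn_if)
  next
    case 3 then show ?thesis using poly_pinfty_gt_lc[of "- p"] by (force simp: sgn_if)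
  qed auto
qed

lemma poly_sgn_at_bot:
  fixes p :: "real poly"
  shows "\<exists>M. \<forall>t\<le>M. sgn (poly p t) = (-1) ^ degree p * sgn (lead_coeff p)"
proof -
  obtain M where M: "\<And>t. t \<ge> M \<Longrightarrow> sgn (poly (pcompose p [:0, -1:]) t) = sgn (lead_coeff (pcompose p [:0, -1:]))"
    using poly_sgn_at_top by blast
  have "lead_coeff (pcompose p [:0, -1:]) = (-1) ^ degree p * lead_coeff p"
    by (subst lead_coeff_comp) auto
  then have "sgn (poly p t) = (-1) ^ degree p * sgn (lead_coeff p)" if "t \<le> - M" for t
    using M[of "- t"] that by (simp add: poly_pcompose sgn_mult power_sgn[symmetric])
  then show ?thesis by blast
qed

lemma poly_sgn_eqI:
  fixes p :: "real poly"
  assumes "\<And>u. s \<le> u \<Longrightarrow> u \<le> t \<Longrightarrow> poly p u \<noteq> 0" "s \<le> t"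
  shows "sgn (poly p s) = sgn (poly p t)"
proof (rule ccontr)
  assume "\<not> ?thesis"
  moreover have "poly p s \<noteq> 0" "poly p t \<noteq> 0" using assms by auto
  ultimately consider "poly p s < 0" "0 < poly p t" | "0 < poly p s" "poly p t < 0"
    by (metis linorder_neqE_linordered_idom sgn_neg sgn_pos)
  then obtain u where "s < u" "u < t" "poly p u = 0"
    using poly_IVT_pos[of s t p] poly_IVT_neg[of s t p] assms(2)
    by (metis less_irrefl less_trans order.order_iff_strict)
  then show False using assms(1) by auto
qed

text \<open>
  A bijection that fixes the roots of \<open>p\<close> maps each interval between them to itself, and \<open>p\<close> has constant
  sign there.
\<close>
lemma order_iso_fixing_roots_sgn:
  fixes p :: "real poly"
  assumes \<phi>: "order_iso \<phi>" and fx: "\<And>t. p \<noteq> 0 \<Longrightarrow> poly p t = 0 \<Longrightarrow> \<phi> t = t"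
  shows "sgn (poly p (\<phi> t)) = sgn (poly p t)"
proof (cases "p = 0 \<or> poly p t = 0")
  case True then show ?thesis using fx by (cases "p = 0") auto
next
  case False
  have nz: "poly p u \<noteq> 0" if "min t (\<phi> t) \<le> u" "u \<le> max t (\<phi> t)" for u
  proof
    assume 0: "poly p u = 0"
    then have "\<phi> u = u" using fx False by blast
    moreover have "u \<noteq> t" using 0 False by auto
    ultimately show False
      using that order_iso_less[OF \<phi>, of u t] order_iso_less[OF \<phi>, of t u]
      by (auto simp: min_def max_def not_less le_less split: if_splits)
  qed
  have "sgn (poly p (min t (\<phi> t))) = sgn (poly p (max t (\<phi> t)))"
    using nz by (intro poly_sgn_eqI) auto
  then show ?thesis by (cases "t \<le> \<phi> t") (simp_all add: min_def max_def)
qed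

lemma poly_comonotone_on_gap:
  fixes q q' :: "real poly"
  assumes h: "order_iso h" and "a < b"
    and d: "\<And>t. sgn (poly (pderiv q) t) = sgn (poly (pderiv q') (h t))"
    and nz: "\<And>t. a < t \<Longrightarrow> t < b \<Longrightarrow> poly (pderiv q) t \<noteq> 0"
  shows "comonotone_on {a..b} (poly q) (\<lambda>t. poly q' (h t))"
proof -
  define s where "s = sgn (poly (pderiv q) ((a + b) / 2))"
  have s: "sgn (poly (pderiv q) t) = s" if "a < t" "t < b" for t
  proof (cases "t \<le> (a + b) / 2")
    case True
    then show ?thesis unfolding s_def using nz that by (intro poly_sgn_eqI) auto
  next
    case False
    then show ?thesis unfolding s_def using nz that by (intro poly_sgn_eqI[symmetric]) auto
  qed
  have "s \<noteq> 0" using nz[of "(a + b) / 2"] \<open>a < b\<close> by (auto simp: s_def sgn_zero_iff)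
  then have s1: "s = 1 \<or> s = - 1" by (auto simp: s_def sgn_if split: if_splits)
  have s': "sgn (poly (pderiv q') u) = s" if "h a < u" "u < h b" for u
  proof -
    obtain t where "u = h t" using h by (auto simp: order_iso_def surj_def)
    then show ?thesis using that s d order_iso_less[OF h] by metis
  qed
  have inc: "poly (smult s p) u < poly (smult s p) v"
    if "u < v" "c \<le> u" "v \<le> d" "\<And>w. c < w \<Longrightarrow> w < d \<Longrightarrow> sgn (poly (pderiv p) w) = s" for u v c d p
  proof (rule DERIV_pos_imp_increasing_open[OF \<open>u < v\<close>])
    fix w assume "u < w" "w < v"
    then have "0 < poly (pderiv (smult s p)) w"
      using that(4)[of w] that(2,3) s1 by (auto simp: pderiv_smult sgn_if split: if_splits)
    then show "\<exists>y. DERIV (poly (smult s p)) w :> y \<and> 0 < y" using poly_DERIV by blast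
  qed (auto intro!: continuous_intros)
  have "poly (smult s q) u < poly (smult s q) v" if "u < v" "a \<le> u" "v \<le> b" for u v
    using inc[OF that] s by blast
  moreover have "poly (smult s q') (h u) < poly (smult s q') (h v)" if "u < v" "a \<le> u" "v \<le> b" for u v
    using inc[of "h u" "h v" "h a" "h b" q'] that s' order_iso_less[OF h] order_iso_le[OF h] by blast
  ultimately show ?thesis using s1
    unfolding comonotone_on_def by (auto intro!: strict_mono_onI)
qed

text \<open>
  The induction step of the elimination method, for polynomials without parameters. The bijection \<open>h\<close>
  matches the signs of the family \<open>p\<close> and of the derivative of \<open>q\<close>; it is corrected inside the
  gaps between their roots so that it matches the signs of \<open>q\<close> as well. This does not disturb
  the signs of the family, which are constant on the gaps.
\<close>
lemma extend_sign_iso: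
  fixes p p' :: "'j \<Rightarrow> real poly" and q q' :: "real poly"
  assumes "finite J" and h: "order_iso h"
    and p: "\<And>j t. j \<in> J \<Longrightarrow> sgn (poly (p j) t) = sgn (poly (p' j) (h t))"
    and deg: "degree q = degree q'" "0 < degree q"
    and lc: "sgn (lead_coeff q) = sgn (lead_coeff q')"
    and d: "\<And>t. sgn (poly (pderiv q) t) = sgn (poly (pderiv q') (h t))"
    and qp: "\<And>j t. j \<in> J \<Longrightarrow> p j \<noteq> 0 \<Longrightarrow> poly (p j) t = 0 \<Longrightarrow> sgn (poly q t) = sgn (poly q' (h t))"
    and qd: "\<And>t. poly (pderiv q) t = 0 \<Longrightarrow> sgn (poly q t) = sgn (poly q' (h t))"
  shows "\<exists>h'. order_iso h' \<and> (\<forall>j\<in>J. \<forall>t. sgn (poly (p j) t) = sgn (poly (p' j) (h' t))) \<and>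
    (\<forall>t. sgn (poly q t) = sgn (poly q' (h' t)))"
proof -
  obtain M1 where M1: "\<And>t. t \<ge> M1 \<Longrightarrow> sgn (poly q t) = sgn (lead_coeff q)"
    using poly_sgn_at_top by blast
  obtain M2 where M2: "\<And>t. t \<ge> M2 \<Longrightarrow> sgn (poly q' t) = sgn (lead_coeff q')"
    using poly_sgn_at_top by blast
  obtain N1 where N1: "\<And>t. t \<le> N1 \<Longrightarrow> sgn (poly q t) = (-1) ^ degree q * sgn (lead_coeff q)"
    using poly_sgn_at_bot by blast
  obtain N2 where N2: "\<And>t. t \<le> N2 \<Longrightarrow> sgn (poly q' t) = (-1) ^ degree q' * sgn (lead_coeff q')"
    using poly_sgn_at_bot by blast
  obtain m2 n2 where mn: "h m2 = M2" "h n2 = N2" using h by (metis order_iso_def surj_def)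
  \<comment> \<open>Adding two points beyond which \<open>q\<close> and \<open>q'\<close> have the signs given by their degrees and leading
    coefficients turns the two unbounded gaps into bounded ones.\<close>
  define M where "M = max M1 m2"
  define N where "N = min N1 n2"
  have top: "sgn (poly q t) = sgn (poly q' (h t))" if "M \<le> t" for t
    using M1[of t] M2[of "h t"] order_iso_le[OF h, of m2 t] that lc mn by (simp add: M_def)
  have bot: "sgn (poly q t) = sgn (poly q' (h t))" if "t \<le> N" for t
    using N1[of t] N2[of "h t"] order_iso_le[OF h, of t n2] that lc mn deg by (simp add: N_def)
  define Z where "Z = {M, N} \<union> {t. poly (pderiv q) t = 0} \<union> (\<Union>j\<in>{j\<in>J. p j \<noteq> 0}. {t. poly (p j) t = 0})"
  have dq: "pderiv q \<noteq> 0" using deg(2) by (simp add: pderiv_eq_0_iff)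
  have finZ: "finite Z"
    using \<open>finite J\<close> dq by (auto simp: Z_def intro!: poly_roots_finite)
  have Zne: "Z \<noteq> {}" by (simp add: Z_def)
  have sZ: "sgn (poly q z) = sgn (poly q' (h z))" if "z \<in> Z" for z
    using that qp qd top bot by (auto simp: Z_def)
  have gap: "comonotone_on {a..b} (poly q) (\<lambda>t. poly q' (h t))"
    if "a < b" "Z \<inter> {a<..<b} = {}" for a b
    using that by (intro poly_comonotone_on_gap h d) (auto simp: Z_def)
  have "continuous_on UNIV (\<lambda>t. poly q' (h t))"
    by (intro continuous_on_poly order_iso_continuous h)
  then have "\<exists>\<phi>. order_iso \<phi> \<and> (\<forall>t\<in>Z. \<phi> t = t) \<and> (\<forall>t. t < Min Z \<or> Max Z < t \<longrightarrow> \<phi> t = t) \<and>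
      (\<forall>t\<in>{Min Z..Max Z}. sgn (poly q t) = sgn (poly q' (h (\<phi> t))))"
    using sZ gap by (intro match_signs_finite finZ Zne) (auto intro!: continuous_intros)
  then obtain \<phi> where \<phi>: "order_iso \<phi>" "\<And>t. t \<in> Z \<Longrightarrow> \<phi> t = t"
      "\<And>t. t < Min Z \<or> Max Z < t \<Longrightarrow> \<phi> t = t"
      "\<And>t. t \<in> {Min Z..Max Z} \<Longrightarrow> sgn (poly q t) = sgn (poly q' (h (\<phi> t)))"
    by blast
  have "M \<in> Z" "N \<in> Z" by (auto simp: Z_def)
  then have MN: "M \<le> Max Z" "Min Z \<le> N" using finZ by auto
  have "sgn (poly q t) = sgn (poly q' (h (\<phi> t)))" for t
    using \<phi>(3)[of t] \<phi>(4)[of t] top[of t] bot[of t] MN by (cases "t \<in> {Min Z..Max Z}") force+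
  moreover have "sgn (poly (p j) t) = sgn (poly (p' j) (h (\<phi> t)))" if "j \<in> J" for j t
  proof -
    have "sgn (poly (p j) (\<phi> t)) = sgn (poly (p j) t)"
      using that by (intro order_iso_fixing_roots_sgn \<phi>) (auto simp: Z_def)
    then show ?thesis using p[OF that, of "\<phi> t"] by simp
  qed
  ultimately show ?thesis using order_iso_comp[OF h \<phi>(1)] by blast
qed

section \<open>Polynomials with parameters\<close>

definition function_ring :: "('x \<Rightarrow> real) set \<Rightarrow> bool" where
  "function_ring R \<longleftrightarrow> (\<forall>c. (\<lambda>_. c) \<in> R) \<and>
    (\<forall>f\<in>R. \<forall>g\<in>R. (\<lambda>x. f x + g x) \<in> R \<and> (\<lambda>x. f x * g x) \<in> R)"

lemma function_ringD:
  assumes "function_ring R"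
  shows "(\<lambda>_. c) \<in> R" "f \<in> R \<Longrightarrow> g \<in> R \<Longrightarrow> (\<lambda>x. f x + g x) \<in> R"
    "f \<in> R \<Longrightarrow> g \<in> R \<Longrightarrow> (\<lambda>x. f x * g x) \<in> R"
    "f \<in> R \<Longrightarrow> g \<in> R \<Longrightarrow> (\<lambda>x. f x - g x) \<in> R"
proof -
  show const: "(\<lambda>_. c) \<in> R" for c using assms by (simp add: function_ring_def)
  show add: "(\<lambda>x. f x + g x) \<in> R" if "f \<in> R" "g \<in> R" for f g
    using assms that by (simp add: function_ring_def)
  show mult: "(\<lambda>x. f x * g x) \<in> R" if "f \<in> R" "g \<in> R" for f g
    using assms that by (simp add: function_ring_def)
  show "(\<lambda>x. f x - g x) \<in> R" if "f \<in> R" "g \<in> R"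
    using add[OF that(1) mult[OF const[of "-1"] that(2)]] by simp
qed

text \<open>
  The leading coefficient comes first, so that the tail of the list is the polynomial that remains
  where the leading coefficient vanishes.
\<close>
fun param_poly :: "('x \<Rightarrow> real) list \<Rightarrow> 'x \<Rightarrow> real poly" where
  "param_poly [] x = 0"
| "param_poly (c # cs) x = monom (c x) (length cs) + param_poly cs x"

lemma degree_param_poly_less: "cs \<noteq> [] \<Longrightarrow> degree (param_poly cs x) < length cs"
proof (induction cs)
  case (Cons c cs)
  have "degree (param_poly cs x) \<le> length cs"
    using Cons.IH by (cases "cs = []") auto
  then have "degree (monom (c x) (length cs) + param_poly cs x) \<le> length cs"
    by (intro degree_add_le) (auto simp: degree_monom_le)
  then show ?case by simp
qed simp

lemma coeff_param_poly_length: "length cs \<le> n \<Longrightarrow> coeff (param_poly cs x) n = 0"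
  by (induction cs) auto

lemma lead_coeff_param_poly:
  assumes "cs \<noteq> []" "hd cs x \<noteq> 0"
  shows "degree (param_poly cs x) = length cs - 1" "lead_coeff (param_poly cs x) = hd cs x"
proof -
  have c: "coeff (param_poly cs x) (length cs - 1) = hd cs x"
    using assms by (cases cs) (auto simp: coeff_param_poly_length)
  then show d: "degree (param_poly cs x) = length cs - 1"
    using degree_param_poly_less[OF assms(1), of x] le_degree[of "param_poly cs x" "length cs - 1"] assms
    by linarith
  show "lead_coeff (param_poly cs x) = hd cs x" using c d by simp
qed

lemma param_poly_tl: "cs \<noteq> [] \<Longrightarrow> hd cs x = 0 \<Longrightarrow> param_poly (tl cs) x = param_poly cs x"
  by (cases cs) auto

fun deriv_coeffs :: "('x \<Rightarrow> real) list \<Rightarrow> ('x \<Rightarrow> real) list" where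
  "deriv_coeffs [] = []"
| "deriv_coeffs (c # cs) = (if cs = [] then [] else (\<lambda>x. real (length cs) * c x) # deriv_coeffs cs)"

lemma length_deriv_coeffs: "length (deriv_coeffs cs) = length cs - 1"
  by (induction cs) auto

lemma param_poly_deriv_coeffs: "param_poly (deriv_coeffs cs) x = pderiv (param_poly cs x)"
  by (induction cs) (auto simp: pderiv_add pderiv_monom length_deriv_coeffs)

lemma set_deriv_coeffs:
  assumes "function_ring R" shows "set cs \<subseteq> R \<Longrightarrow> set (deriv_coeffs cs) \<subseteq> R"
  by (induction cs) (auto intro!: function_ringD[OF assms])

lemma poly_param_poly_combination:
  "length us = length vs \<Longrightarrow>
    poly (param_poly (map2 (\<lambda>u v x. a x * u x - b x * v x) us vs) x) t =
    a x * poly (param_poly us x) t - b x * poly (param_poly vs x) t"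
  by (induction us vs rule: list_induct2) (auto simp: poly_monom algebra_simps)

lemma poly_param_poly_shift:
  "poly (param_poly (cs @ replicate m (\<lambda>_. 0)) x) t = t ^ m * poly (param_poly cs x) t"
proof (induction cs)
  case Nil
  then show ?case by (induction m) auto
qed (auto simp: poly_monom power_add algebra_simps)

text \<open>
  At a root of \<open>g\<close> the sign of \<open>f\<close> is that of a polynomial shorter than \<open>g\<close>. The even exponent
  makes the factor a square, so that it does not change the sign where the leading
  coefficient of \<open>g\<close> is nonzero.
\<close>
lemma pseudo_remainder:
  assumes R: "function_ring R" and "set f \<subseteq> R" "set g \<subseteq> R" "g \<noteq> []"
  shows "\<exists>r k. length r < length g \<and> set r \<subseteq> R \<and> (\<forall>x t. poly (param_poly g x) t = 0 \<longrightarrow>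
    poly (param_poly r x) t = hd g x ^ (2 * k) * poly (param_poly f x) t)"
  using assms(2)
proof (induction f rule: length_induct)
  case (1 f)
  show ?case
  proof (cases "length f < length g")
    case True
    then show ?thesis using 1 by (intro exI[of _ f] exI[of _ 0]) auto
  next
    case False
    obtain b bs where g: "g = b # bs" using \<open>g \<noteq> []\<close> by (cases g) auto
    obtain c cs where f: "f = c # cs" using False \<open>g \<noteq> []\<close> by (cases f) auto
    define m where "m = length cs - length bs"
    define zs where "zs = bs @ replicate m (\<lambda>_. 0)"
    \<comment> \<open>The combination \<open>b\<^sup>2 f - b c t\<^sup>m g\<close>, whose leading terms cancel.\<close>
    define f1 where "f1 = map2 (\<lambda>u v x. (b x * b x) * u x - (c x * b x) * v x) cs zs"
    have len: "length bs + m = length cs" using False by (simp add: f g m_def)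
    have lz: "length cs = length zs" using len by (simp add: zs_def)
    have mem: "b \<in> R" "c \<in> R" "set cs \<subseteq> R" "set zs \<subseteq> R"
      using 1 assms function_ringD(1)[OF R] by (auto simp: f g zs_def)
    have "set f1 \<subseteq> R"
    proof
      fix w assume "w \<in> set f1"
      then obtain u v where "u \<in> set cs" "v \<in> set zs" "w = (\<lambda>x. (b x * b x) * u x - (c x * b x) * v x)"
        by (auto simp: f1_def dest: set_zip_leftD set_zip_rightD)
      then show "w \<in> R"
        using mem by (auto intro!: function_ringD[OF R])
    qed
    moreover have "length f1 < length f" using lz by (simp add: f f1_def)
    ultimately obtain r k where r: "length r < length g" "set r \<subseteq> R"
        "\<And>x t. poly (param_poly g x) t = 0 \<Longrightarrow>
          poly (param_poly r x) t = hd g x ^ (2 * k) * poly (param_poly f1 x) t"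
      using 1 by blast
    have "poly (param_poly f1 x) t = hd g x ^ 2 * poly (param_poly f x) t"
      if "poly (param_poly g x) t = 0" for x t
    proof -
      have bs: "poly (param_poly bs x) t = - b x * t ^ length bs"
        using that by (simp add: g poly_monom)
      have "poly (param_poly f1 x) t =
          b x * b x * poly (param_poly cs x) t - c x * b x * (t ^ m * poly (param_poly bs x) t)"
        unfolding f1_def
        by (subst poly_param_poly_combination[OF lz]) (simp add: zs_def poly_param_poly_shift)
      also have "\<dots> = b x * b x * (poly (param_poly cs x) t + c x * t ^ (length bs + m))"
        by (simp add: bs power_add algebra_simps)
      finally show ?thesis by (simp add: len f g poly_monom power2_eq_square)
    qed
    then have "poly (param_poly r x) t = hd g x ^ (2 * (k + 1)) * poly (param_poly f x) t"
      if "poly (param_poly g x) t = 0" for x t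
      using r(3)[OF that] that by (simp add: power_add power2_eq_square algebra_simps)
    then show ?thesis using r(1,2) by blast
  qed
qed

section \<open>Sign patterns are determined by finitely many coefficient polynomials\<close>

definition same_signs :: "('x \<Rightarrow> real) set \<Rightarrow> 'x \<Rightarrow> 'x \<Rightarrow> bool" where
  "same_signs B x y \<longleftrightarrow> (\<forall>b\<in>B. sgn (b x) = sgn (b y))"

lemma same_signs_mono: "same_signs B x y \<Longrightarrow> A \<subseteq> B \<Longrightarrow> same_signs A x y"
  by (auto simp: same_signs_def)

definition sign_iso :: "('x \<Rightarrow> real) list set \<Rightarrow> 'x \<Rightarrow> 'x \<Rightarrow> (real \<Rightarrow> real) \<Rightarrow> bool" where
  "sign_iso P x y h \<longleftrightarrow> order_iso h \<and>
    (\<forall>f\<in>P. \<forall>t. sgn (poly (param_poly f x) t) = sgn (poly (param_poly f y) (h t)))"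

text \<open>
  The hypothesis on \<open>h\<close> covers the remainders \<open>r g\<close> because they control the sign of \<open>f\<close> at the roots of the
  other members and of the derivative. All leading coefficients are nonzero, so the lengths give the
  degrees, and the even powers of leading coefficients are positive.
\<close>
lemma sign_iso_insert:
  assumes "finite P" and nz: "f \<noteq> []" "hd f x \<noteq> 0" "\<And>g. g \<in> P \<Longrightarrow> g \<noteq> [] \<Longrightarrow> hd g x \<noteq> 0"
    and hd: "\<And>g. g \<in> insert f P \<Longrightarrow> g \<noteq> [] \<Longrightarrow> sgn (hd g x) = sgn (hd g y)"
    and len: "1 < length f"
    and r: "\<And>g x t. g \<in> insert (deriv_coeffs f) P \<Longrightarrow> g \<noteq> [] \<Longrightarrow> poly (param_poly g x) t = 0 \<Longrightarrow>
        poly (param_poly (r g) x) t = hd g x ^ (2 * k g) * poly (param_poly f x) t"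
    and h: "sign_iso (insert (deriv_coeffs f) P \<union> r ` {g \<in> insert (deriv_coeffs f) P. g \<noteq> []}) x y h"
  shows "\<exists>h'. sign_iso (insert f P) x y h'"
proof -
  let ?q = "param_poly f x" and ?q' = "param_poly f y"
  have hdy: "hd g y \<noteq> 0" if "g \<in> insert f P" "g \<noteq> []" for g
    using hd[OF that] nz that by (auto simp: sgn_zero_iff)
  have lc: "degree ?q = length f - 1" "lead_coeff ?q = hd f x"
      "degree ?q' = length f - 1" "lead_coeff ?q' = hd f y"
    using lead_coeff_param_poly[OF nz(1)] nz(2) hdy nz(1) by auto
  have df: "deriv_coeffs f \<noteq> []" "hd (deriv_coeffs f) z = real (length f - 1) * hd f z" for z
    using len by (cases f; auto)+
  have root: "sgn (poly ?q t) = sgn (poly ?q' (h t))"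
    if g: "g \<in> insert (deriv_coeffs f) P" "g \<noteq> []" and 0: "poly (param_poly g x) t = 0" for g t
  proof -
    have "sgn (poly (param_poly g x) t) = sgn (poly (param_poly g y) (h t))"
      using h g(1) unfolding sign_iso_def by blast
    then have "poly (param_poly g y) (h t) = 0"
      using 0 by (metis sgn_0 sgn_zero_iff)
    moreover have "hd g x \<noteq> 0" "hd g y \<noteq> 0"
    proof -
      consider "g = deriv_coeffs f" | "g \<in> P" using g(1) by blast
      then have "hd g x \<noteq> 0 \<and> hd g y \<noteq> 0"
      proof cases
        case 1
        then show ?thesis using nz(1,2) hdy[of f] df(2) len by simp
      next
        case 2
        then show ?thesis using nz(3) hdy g(2) by blast
      qed
      then show "hd g x \<noteq> 0" "hd g y \<noteq> 0" by auto
    qed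
    moreover have "sgn (poly (param_poly (r g) x) t) = sgn (poly (param_poly (r g) y) (h t))"
      using h g unfolding sign_iso_def by blast
    ultimately show ?thesis
      using r[OF g 0] r[OF g, of y "h t"]
      by (simp add: sgn_mult) (simp add: sgn_if power_mult power_one_right split: if_splits)
  qed
  have "\<exists>h'. order_iso h' \<and>
      (\<forall>g\<in>P. \<forall>t. sgn (poly (param_poly g x) t) = sgn (poly (param_poly g y) (h' t))) \<and>
      (\<forall>t. sgn (poly ?q t) = sgn (poly ?q' (h' t)))"
  proof (rule extend_sign_iso[OF \<open>finite P\<close>])
    show "order_iso h" using h by (simp add: sign_iso_def)
    show "sgn (poly (param_poly g x) t) = sgn (poly (param_poly g y) (h t))" if "g \<in> P" for g t
      using h that by (auto simp: sign_iso_def)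
    show "degree ?q = degree ?q'" "0 < degree ?q" using lc len by auto
    show "sgn (lead_coeff ?q) = sgn (lead_coeff ?q')" using hd[of f] nz(1) lc(2,4) by (metis insertI1)
    show "sgn (poly (pderiv ?q) t) = sgn (poly (pderiv ?q') (h t))" for t
      using h by (auto simp: sign_iso_def param_poly_deriv_coeffs)
    show "sgn (poly ?q t) = sgn (poly ?q' (h t))"
      if "g \<in> P" "param_poly g x \<noteq> 0" "poly (param_poly g x) t = 0" for g t
      using root[of g t] that by (cases "g = []") auto
    show "sgn (poly ?q t) = sgn (poly ?q' (h t))" if "poly (pderiv ?q) t = 0" for t
      using root[of "deriv_coeffs f" t] that df by (simp add: param_poly_deriv_coeffs)
  qed
  then show ?thesis by (auto simp: sign_iso_def)
qed

text \<open>
  Induction along the multiset order on lengths. Where some leading coefficient vanishes, that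
  polynomial is replaced by its tail. Elsewhere a longest polynomial \<open>f\<close> is replaced by its derivative
  and its pseudo-remainders with respect to the derivative and to the other members, all of
  which are shorter than \<open>f\<close>. The signs of the leading coefficients tell which case applies.
\<close>
theorem sign_iso_of_same_signs:
  assumes R: "function_ring R" and "\<forall>f\<in>#M. set f \<subseteq> R"
  shows "\<exists>B. finite B \<and> B \<subseteq> R \<and> (\<forall>x y. same_signs B x y \<longrightarrow> (\<exists>h. sign_iso (set_mset M) x y h))"
  using assms(2)
proof (induction M rule: wf_induct_rule[OF wf_mult[OF wf_measure[of length]]])
  case (1 M)
  show ?case
  proof (cases "M = {#}")
    case True
    then show ?thesis by (intro exI[of _ "{}"]) (auto simp: sign_iso_def intro: order_iso_id)
  next
    case False
    have replace: "\<exists>B. finite B \<and> B \<subseteq> R \<and>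
        (\<forall>x y. same_signs B x y \<longrightarrow> (\<exists>h. sign_iso (set_mset (M - {#f#}) \<union> set_mset K) x y h))"
      if "f \<in># M" "\<forall>k\<in>#K. length k < length f \<and> set k \<subseteq> R" for f K
    proof -
      have "(M - {#f#} + K, M) \<in> mult (Wellfounded.measure length)"
        using that one_step_implies_mult[of "{#f#}" K "Wellfounded.measure length" "M - {#f#}"] by auto
      moreover have "\<forall>g\<in>#M - {#f#} + K. set g \<subseteq> R"
        using 1(2) that(2) by (auto dest!: in_diffD)
      ultimately show ?thesis
        using 1(1)[of "M - {#f#} + K"] by simp
    qed
    have "Max (length ` set_mset M) \<in> length ` set_mset M"
      using False by (intro Max_in) auto
    then obtain f where f: "f \<in># M" "length f = Max (length ` set_mset M)" by auto
    have max: "length g \<le> length f" if "g \<in># M" for g using that by (simp add: f(2))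
    define P where "P = set_mset (M - {#f#})"
    have P: "finite P" "insert f P = set_mset M"
      using f(1) unfolding P_def by (simp_all flip: set_mset_add_mset_insert)
    show ?thesis
    proof (cases "length f \<le> 1")
      case True
      obtain B where B: "finite B" "B \<subseteq> R" "\<And>x y. same_signs B x y \<Longrightarrow> \<exists>h. sign_iso P x y h"
        using replace[OF f(1), of "{#}"] by (auto simp: P_def)
      have "\<exists>h. sign_iso (set_mset M) x y h" if ss: "same_signs (B \<union> set f) x y" for x y
      proof -
        obtain h where "sign_iso P x y h" using B(3) same_signs_mono[OF ss] by blast
        moreover have "sgn (poly (param_poly f x) t) = sgn (poly (param_poly f y) u)" for t u
          using True ss by (cases f) (auto simp: same_signs_def poly_monom)
        ultimately show ?thesis unfolding P(2)[symmetric] by (auto simp: sign_iso_def)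
      qed
      then show ?thesis using B 1(2) f(1) by (intro exI[of _ "B \<union> set f"]) auto
    next
      case long: False
      define Q where "Q = insert (deriv_coeffs f) P"
      have QR: "set g \<subseteq> R" "length g \<le> length f" if "g \<in> Q" for g
      proof -
        have "g = deriv_coeffs f \<or> g \<in># M" using that P(2) by (auto simp: Q_def)
        then show "set g \<subseteq> R" "length g \<le> length f"
          using 1(2) f(1) set_deriv_coeffs[OF R, of f] max by (auto simp: length_deriv_coeffs)
      qed
      define Q' where "Q' = {g \<in> Q. g \<noteq> []}"
      have "\<forall>g\<in>Q'. \<exists>r k. length r < length g \<and> set r \<subseteq> R \<and> (\<forall>x t. poly (param_poly g x) t = 0 \<longrightarrow>
            poly (param_poly r x) t = hd g x ^ (2 * k) * poly (param_poly f x) t)"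
        using QR(1) 1(2) f(1) by (intro ballI pseudo_remainder[OF R]) (auto simp: Q'_def)
      from bchoice[OF this] obtain rem where
        "\<forall>g\<in>Q'. \<exists>k. length (rem g) < length g \<and> set (rem g) \<subseteq> R \<and>
          (\<forall>x t. poly (param_poly g x) t = 0 \<longrightarrow>
            poly (param_poly (rem g) x) t = hd g x ^ (2 * k) * poly (param_poly f x) t)" by blast
      from bchoice[OF this] obtain k where
        rem: "\<And>g. g \<in> Q' \<Longrightarrow> length (rem g) < length g" "\<And>g. g \<in> Q' \<Longrightarrow> set (rem g) \<subseteq> R"
          "\<And>g x t. g \<in> Q' \<Longrightarrow> poly (param_poly g x) t = 0 \<Longrightarrow>
            poly (param_poly (rem g) x) t = hd g x ^ (2 * k g) * poly (param_poly f x) t" by blast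
      define K where "K = mset_set (insert (deriv_coeffs f) (rem ` Q'))"
      have fin: "finite Q'" using P by (simp add: Q_def Q'_def)
      have setK: "set_mset K = insert (deriv_coeffs f) (rem ` Q')"
        using fin by (simp add: K_def)
      have "\<forall>k\<in>#K. length k < length f \<and> set k \<subseteq> R"
      proof
        fix k assume "k \<in># K"
        then consider "k = deriv_coeffs f" | g where "g \<in> Q'" "k = rem g" unfolding setK by blast
        then show "length k < length f \<and> set k \<subseteq> R"
        proof cases
          case 1
          then show ?thesis using QR(1)[of k] long by (auto simp: length_deriv_coeffs Q_def)
        next
          case 2
          then show ?thesis using rem(1,2)[of g] QR(2)[of g] by (auto simp: Q'_def)
        qed
      qed
      then obtain B0 where B0: "finite B0" "B0 \<subseteq> R"
          "\<And>x y. same_signs B0 x y \<Longrightarrow> \<exists>h. sign_iso (Q \<union> rem ` Q') x y h"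
        using replace[OF f(1), of K] unfolding setK Q_def P_def by (auto simp: Un_commute)
      have "\<forall>g. \<exists>B. g \<in># M \<and> g \<noteq> [] \<longrightarrow> finite B \<and> B \<subseteq> R \<and> (\<forall>x y. same_signs B x y \<longrightarrow>
          (\<exists>h. sign_iso (set_mset (M - {#g#}) \<union> {tl g}) x y h))"
      proof (intro allI)
        fix g
        show "\<exists>B. g \<in># M \<and> g \<noteq> [] \<longrightarrow> finite B \<and> B \<subseteq> R \<and> (\<forall>x y. same_signs B x y \<longrightarrow>
          (\<exists>h. sign_iso (set_mset (M - {#g#}) \<union> {tl g}) x y h))"
        proof (cases "g \<in># M \<and> g \<noteq> []")
          case True
          then have "set (tl g) \<subseteq> R" using 1(2) by (auto dest: list.set_sel(2))
          then show ?thesis using True replace[of g "{#tl g#}"] by auto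
        qed auto
      qed
      then obtain T where T: "\<And>g. g \<in># M \<Longrightarrow> g \<noteq> [] \<Longrightarrow> finite (T g)"
          "\<And>g. g \<in># M \<Longrightarrow> g \<noteq> [] \<Longrightarrow> T g \<subseteq> R"
          "\<And>g x y. g \<in># M \<Longrightarrow> g \<noteq> [] \<Longrightarrow> same_signs (T g) x y \<Longrightarrow>
            \<exists>h. sign_iso (set_mset (M - {#g#}) \<union> {tl g}) x y h"
        by metis
      define N where "N = {g \<in> set_mset M. g \<noteq> []}"
      define B where "B = hd ` N \<union> B0 \<union> (\<Union>g\<in>N. T g)"
      have "finite B" "B \<subseteq> R"
      proof -
        have "hd g \<in> R \<and> T g \<subseteq> R" if "g \<in> N" for g
          using that T(2)[of g] 1(2) list.set_sel(1)[of g] unfolding N_def by blast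
        then show "finite B" "B \<subseteq> R"
          using B0(1,2) T(1) by (auto simp: B_def N_def)
      qed
      moreover have "\<exists>h. sign_iso (set_mset M) x y h" if ss: "same_signs B x y" for x y
      proof (cases "\<exists>g\<in>N. hd g x = 0")
        case True
        then obtain g where g: "g \<in> N" "hd g x = 0" by blast
        have "sgn (hd g x) = sgn (hd g y)" using ss g(1) by (auto simp: same_signs_def B_def)
        then have "hd g y = 0" using g(2) by (metis sgn_0 sgn_zero_iff)
        then have eq: "param_poly (tl g) x = param_poly g x" "param_poly (tl g) y = param_poly g y"
          using g by (auto simp: N_def param_poly_tl)
        obtain h where h: "sign_iso (set_mset (M - {#g#}) \<union> {tl g}) x y h"
          using T(3)[of g x y] g(1) same_signs_mono[OF ss, of "T g"] by (auto simp: N_def B_def)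
        have "set_mset M = insert g (set_mset (M - {#g#}))"
          using g(1) unfolding N_def by (simp flip: set_mset_add_mset_insert)
        then have "sign_iso (set_mset M) x y h"
          using h eq by (auto simp: sign_iso_def)
        then show ?thesis by blast
      next
        case nz: False
        obtain h where h: "sign_iso (Q \<union> rem ` Q') x y h"
          using B0(3) same_signs_mono[OF ss, of B0] by (auto simp: B_def)
        have "\<exists>h'. sign_iso (insert f P) x y h'"
        proof (rule sign_iso_insert[where r = rem and k = k])
          show "sign_iso (insert (deriv_coeffs f) P \<union> rem ` {g \<in> insert (deriv_coeffs f) P. g \<noteq> []}) x y h"
            using h by (simp add: Q_def Q'_def)
          show "f \<noteq> []" "1 < length f" using long by auto
          show "hd f x \<noteq> 0" using nz f(1) \<open>f \<noteq> []\<close> by (auto simp: N_def)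
          show "hd g x \<noteq> 0" if "g \<in> P" "g \<noteq> []" for g
            using nz that P(2) by (auto simp: N_def)
          show "sgn (hd g x) = sgn (hd g y)" if "g \<in> insert f P" "g \<noteq> []" for g
            using ss that P(2) by (auto simp: N_def B_def same_signs_def)
          show "poly (param_poly (rem g) x) t = hd g x ^ (2 * k g) * poly (param_poly f x) t"
            if "g \<in> insert (deriv_coeffs f) P" "g \<noteq> []" "poly (param_poly g x) t = 0" for g x t
            using rem(3) that by (simp add: Q_def Q'_def)
        qed (rule P(1))
        then show ?thesis by (simp add: P(2))
      qed
      ultimately show ?thesis by blast
    qed
  qed
qed

section \<open>Sets determined by the signs of finitely many functions\<close>

text \<open>
  For a ring of polynomials these are the semi-algebraic sets. Equality of signs is the natural
  interface to \<open>sign_iso_of_same_signs\<close>, and no normal form has to be maintained.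
\<close>
definition sign_determined :: "('x \<Rightarrow> real) set \<Rightarrow> 'x set \<Rightarrow> bool" where
  "sign_determined R S \<longleftrightarrow> (\<exists>B. finite B \<and> B \<subseteq> R \<and>
    (\<forall>x y. same_signs B x y \<longrightarrow> x \<in> S \<longleftrightarrow> y \<in> S))"

lemma sign_determined_Int:
  assumes "sign_determined R S" "sign_determined R T"
  shows "sign_determined R (S \<inter> T)"
proof -
  obtain A B where A: "finite A" "A \<subseteq> R" "\<And>x y. same_signs A x y \<Longrightarrow> x \<in> S \<longleftrightarrow> y \<in> S"
    and B: "finite B" "B \<subseteq> R" "\<And>x y. same_signs B x y \<Longrightarrow> x \<in> T \<longleftrightarrow> y \<in> T"
    using assms unfolding sign_determined_def by metis
  have "x \<in> S \<inter> T \<longleftrightarrow> y \<in> S \<inter> T" if "same_signs (A \<union> B) x y" for x y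
    using A(3)[of x y] B(3)[of x y] that unfolding same_signs_def by blast
  then show ?thesis
    using A(1,2) B(1,2) unfolding sign_determined_def by (intro exI[of _ "A \<union> B"]) auto
qed

lemma sign_determined_Compl: "sign_determined R S \<Longrightarrow> sign_determined R (- S)"
  unfolding sign_determined_def by blast

lemma sign_determined_UNIV: "sign_determined R UNIV"
  unfolding sign_determined_def by blast

lemma sign_determined_Diff:
  "sign_determined R S \<Longrightarrow> sign_determined R T \<Longrightarrow> sign_determined R (S - T)"
  unfolding Diff_eq by (intro sign_determined_Int sign_determined_Compl)

lemma sign_determined_INT:
  "finite I \<Longrightarrow> (\<And>i. i \<in> I \<Longrightarrow> sign_determined R (S i)) \<Longrightarrow> sign_determined R (\<Inter>i\<in>I. S i)"
  by (induction I rule: finite_induct) (auto intro: sign_determined_UNIV sign_determined_Int)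

lemma sign_determined_UN:
  "finite I \<Longrightarrow> (\<And>i. i \<in> I \<Longrightarrow> sign_determined R (S i)) \<Longrightarrow> sign_determined R (\<Union>i\<in>I. S i)"
  using sign_determined_Compl[OF sign_determined_INT[of I R "\<lambda>i. - S i"]]
  by (simp add: sign_determined_Compl)

lemma sign_determined_Collect:
  assumes "b \<in> R" "\<And>r s. sgn r = sgn s \<Longrightarrow> P r \<longleftrightarrow> P s"
  shows "sign_determined R {x. P (b x)}"
  unfolding sign_determined_def same_signs_def mem_Collect_eq
  by (intro exI[of _ "{b}"] conjI allI impI assms(2)) (use assms(1) in simp_all)

lemma sign_determined_vimage:
  assumes "sign_determined R S" "\<And>b. b \<in> R \<Longrightarrow> (\<lambda>x. b (f x)) \<in> R'"
  shows "sign_determined R' (f -` S)"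
proof -
  obtain B where "finite B" "B \<subseteq> R" "\<And>x y. same_signs B x y \<Longrightarrow> x \<in> S \<longleftrightarrow> y \<in> S"
    using assms(1) unfolding sign_determined_def by metis
  then show ?thesis
    unfolding sign_determined_def using assms(2)
    by (intro exI[of _ "(\<lambda>b x. b (f x)) ` B"]) (auto simp: same_signs_def subset_iff)
qed

section \<open>Projections: the Tarski--Seidenberg theorem\<close>

text \<open>
  With sequences instead of vectors all dimensions share one type, which makes induction on the
  dimension possible; a set determined by the signs of these polynomials is a cylinder over a subset of \<open>n\<close>-space.
\<close>
inductive_set coord_polys :: "nat \<Rightarrow> ((nat \<Rightarrow> real) \<Rightarrow> real) set" for n where
  const: "(\<lambda>_. c) \<in> coord_polys n"
| coord: "i < n \<Longrightarrow> (\<lambda>x. x i) \<in> coord_polys n"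
| add: "f \<in> coord_polys n \<Longrightarrow> g \<in> coord_polys n \<Longrightarrow> (\<lambda>x. f x + g x) \<in> coord_polys n"
| mult: "f \<in> coord_polys n \<Longrightarrow> g \<in> coord_polys n \<Longrightarrow> (\<lambda>x. f x * g x) \<in> coord_polys n"

lemma function_ring_coord_polys: "function_ring (coord_polys n)"
  unfolding function_ring_def by (auto intro: coord_polys.intros)

lemma coord_polys_cong: "f \<in> coord_polys n \<Longrightarrow> (\<And>i. i < n \<Longrightarrow> x i = y i) \<Longrightarrow> f x = f y"
  by (induction rule: coord_polys.induct) auto

lemma coord_polys_sum:
  "finite I \<Longrightarrow> (\<And>i. i \<in> I \<Longrightarrow> f i \<in> coord_polys n) \<Longrightarrow> (\<lambda>x. \<Sum>i\<in>I. f i x) \<in> coord_polys n"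
  by (induction I rule: finite_induct) (auto intro: coord_polys.intros)

lemma coord_polys_continuous: "f \<in> coord_polys n \<Longrightarrow> continuous_on UNIV f"
  by (induction rule: coord_polys.induct) (auto intro!: continuous_intros)

lemma param_poly_pad:
  "param_poly (replicate m (\<lambda>_. 0) @ cs) x = param_poly cs x"
  by (induction m) auto

lemma param_poly_add:
  fixes R :: "('x \<Rightarrow> real) set"
  assumes R: "function_ring R" and "set cs \<subseteq> R" "set ds \<subseteq> R"
  shows "\<exists>es. set es \<subseteq> R \<and> (\<forall>x. param_poly es x = param_poly cs x + param_poly ds x)"
proof -
  define n where "n = max (length cs) (length ds)"
  define us where "us = replicate (n - length cs) (\<lambda>_. 0) @ cs"
  define vs where "vs = replicate (n - length ds) (\<lambda>_. 0) @ ds"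
  have sub: "set us \<subseteq> R" "set vs \<subseteq> R" using assms function_ringD(1)[OF R] by (auto simp: us_def vs_def)
  have "param_poly (map2 (\<lambda>u v x. u x + v x) us vs) x = param_poly us x + param_poly vs x"
    if "length us = length vs" for x and us vs :: "('x \<Rightarrow> real) list"
    using that by (induction us vs rule: list_induct2) (auto simp: add_monom[symmetric])
  moreover have "length us = length vs" by (auto simp: us_def vs_def n_def)
  moreover have "set (map2 (\<lambda>u v x. u x + v x) us vs) \<subseteq> R"
  proof
    fix w assume "w \<in> set (map2 (\<lambda>u v x. u x + v x) us vs)"
    then obtain u v where "u \<in> set us" "v \<in> set vs" "w = (\<lambda>x. u x + v x)"
      by (auto dest: set_zip_leftD set_zip_rightD)
    then show "w \<in> R" using sub by (auto intro!: function_ringD[OF R])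
  qed
  ultimately show ?thesis
    by (intro exI[of _ "map2 (\<lambda>u v x. u x + v x) us vs"]) (simp add: us_def vs_def param_poly_pad)
qed

lemma param_poly_mult:
  assumes R: "function_ring R" and "set cs \<subseteq> R" "set ds \<subseteq> R"
  shows "\<exists>es. set es \<subseteq> R \<and> (\<forall>x t. poly (param_poly es x) t = poly (param_poly cs x) t * poly (param_poly ds x) t)"
  using assms(2)
proof (induction cs)
  case Nil
  then show ?case by (intro exI[of _ "[]"]) auto
next
  case (Cons c cs)
  then obtain es where es: "set es \<subseteq> R"
    "\<And>x t. poly (param_poly es x) t = poly (param_poly cs x) t * poly (param_poly ds x) t" by auto
  define fs where "fs = map (\<lambda>d x. c x * d x) ds @ replicate (length cs) (\<lambda>_. 0)"
  have scale: "poly (param_poly (map (\<lambda>d x. c x * d x) ds) x) t = c x * poly (param_poly ds x) t" for x t ds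
    by (induction ds) (auto simp: poly_monom algebra_simps)
  have "set fs \<subseteq> R"
    using Cons.prems assms(3) by (auto simp: fs_def intro!: function_ringD[OF R])
  then obtain hs where hs: "set hs \<subseteq> R" "\<And>x. param_poly hs x = param_poly fs x + param_poly es x"
    using param_poly_add[OF R _ es(1)] by metis
  have "poly (param_poly hs x) t = poly (param_poly (c # cs) x) t * poly (param_poly ds x) t" for x t
    unfolding hs(2) fs_def by (simp add: es(2) poly_param_poly_shift scale poly_monom distrib_right)
  then show ?case using hs(1) by blast
qed

text \<open>
  The functions given by coefficient lists contain the constants and coordinates and are closed under
  addition and multiplication.
\<close>
lemma coord_polys_Suc:
  assumes "f \<in> coord_polys (Suc n)"
  shows "\<exists>cs. set cs \<subseteq> coord_polys n \<and> (\<forall>x. f x = poly (param_poly cs x) (x n))"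
  using assms
proof (induction rule: coord_polys.induct)
  case (const c)
  show ?case by (intro exI[of _ "[\<lambda>_. c]"]) (auto simp: poly_monom intro: coord_polys.intros)
next
  case (coord i)
  show ?case
  proof (cases "i < n")
    case True
    then show ?thesis
      by (intro exI[of _ "[\<lambda>x. x i]"]) (auto simp: poly_monom intro: coord_polys.intros)
  next
    case False
    then have "i = n" using coord by simp
    then show ?thesis
      by (intro exI[of _ "[\<lambda>_. 1, \<lambda>_. 0]"]) (auto simp: poly_monom intro: coord_polys.intros)
  qed
next
  case (add f g)
  then obtain cs ds where cd: "set cs \<subseteq> coord_polys n" "\<And>x. f x = poly (param_poly cs x) (x n)"
    "set ds \<subseteq> coord_polys n" "\<And>x. g x = poly (param_poly ds x) (x n)" by blast
  obtain es where "set es \<subseteq> coord_polys n" "\<And>x. param_poly es x = param_poly cs x + param_poly ds x"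
    using param_poly_add[OF function_ring_coord_polys cd(1,3)] by blast
  then show ?case by (intro exI[of _ es]) (simp add: cd(2,4))
next
  case (mult f g)
  then obtain cs ds where cd: "set cs \<subseteq> coord_polys n" "\<And>x. f x = poly (param_poly cs x) (x n)"
    "set ds \<subseteq> coord_polys n" "\<And>x. g x = poly (param_poly ds x) (x n)" by blast
  obtain es where "set es \<subseteq> coord_polys n"
      "\<And>x t. poly (param_poly es x) t = poly (param_poly cs x) t * poly (param_poly ds x) t"
    using param_poly_mult[OF function_ring_coord_polys cd(1,3)] by blast
  then show ?case by (intro exI[of _ es]) (simp add: cd(2,4))
qed

lemma param_poly_cong:
  assumes "set cs \<subseteq> coord_polys n" "\<And>i. i < n \<Longrightarrow> x i = y i"
  shows "param_poly cs x = param_poly cs y"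
proof -
  have "\<And>c. c \<in> set cs \<Longrightarrow> c x = c y" using assms coord_polys_cong by blast
  then show ?thesis by (induction cs) auto
qed

lemma coord_polys_coeff_lists:
  assumes "finite B" "B \<subseteq> coord_polys (Suc n)"
  shows "\<exists>L. finite L \<and> (\<forall>f\<in>L. set f \<subseteq> coord_polys n) \<and>
    (\<forall>b\<in>B. \<exists>f\<in>L. \<forall>x t. b (x(n := t)) = poly (param_poly f x) t)"
proof -
  have "\<forall>b\<in>B. \<exists>cs. set cs \<subseteq> coord_polys n \<and> (\<forall>x. b x = poly (param_poly cs x) (x n))"
    using assms coord_polys_Suc by blast
  then obtain C where C: "\<And>b. b \<in> B \<Longrightarrow> set (C b) \<subseteq> coord_polys n"
      "\<And>b x. b \<in> B \<Longrightarrow> b x = poly (param_poly (C b) x) (x n)" by metis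
  have "b (x(n := t)) = poly (param_poly (C b) x) t" if "b \<in> B" for b x t
    using C(2)[OF that, of "x(n := t)"] param_poly_cong[OF C(1)[OF that], of "x(n := t)" x] by simp
  then show ?thesis using C(1) assms(1) by (intro exI[of _ "C ` B"]) auto
qed

lemma sign_iso_of_same_signs_set:
  assumes "function_ring R" "finite L" "\<forall>f\<in>L. set f \<subseteq> R"
  shows "\<exists>B. finite B \<and> B \<subseteq> R \<and> (\<forall>x y. same_signs B x y \<longrightarrow> (\<exists>h. sign_iso L x y h))"
  using sign_iso_of_same_signs[OF assms(1), of "mset_set L"] assms(2,3) by simp

text \<open>
  If the polynomials of \<open>sign_iso_of_same_signs\<close> have the same signs at \<open>x\<close> and \<open>y\<close>, then a
  witness \<open>t\<close> over \<open>x\<close> is carried by the bijection to a witness over \<open>y\<close>.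
\<close>
theorem sign_determined_projection:
  assumes "sign_determined (coord_polys (Suc n)) S"
  shows "sign_determined (coord_polys n) {x. \<exists>t. x(n := t) \<in> S}"
proof -
  obtain B where B: "finite B" "B \<subseteq> coord_polys (Suc n)" "\<And>x y. same_signs B x y \<Longrightarrow> x \<in> S \<longleftrightarrow> y \<in> S"
    using assms unfolding sign_determined_def by metis
  obtain L where L: "finite L" "\<forall>f\<in>L. set f \<subseteq> coord_polys n"
      "\<And>b. b \<in> B \<Longrightarrow> \<exists>f\<in>L. \<forall>x t. b (x(n := t)) = poly (param_poly f x) t"
    using coord_polys_coeff_lists[OF B(1,2)] by metis
  obtain A where A: "finite A" "A \<subseteq> coord_polys n" "\<And>x y. same_signs A x y \<Longrightarrow> \<exists>h. sign_iso L x y h"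
    using sign_iso_of_same_signs_set[OF function_ring_coord_polys L(1,2)] by metis
  have imp: "\<exists>t. y(n := t) \<in> S" if xy: "same_signs A x y" and ex: "\<exists>t. x(n := t) \<in> S" for x y
  proof -
    obtain t where t: "x(n := t) \<in> S" using ex by blast
    obtain h where h: "sign_iso L x y h" using A(3)[OF xy] by blast
    have "same_signs B (x(n := t)) (y(n := h t))"
      unfolding same_signs_def
    proof
      fix b assume "b \<in> B"
      then obtain f where "f \<in> L" "\<And>x t. b (x(n := t)) = poly (param_poly f x) t" using L(3) by metis
      then show "sgn (b (x(n := t))) = sgn (b (y(n := h t)))" using h by (simp add: sign_iso_def)
    qed
    then show ?thesis using B(3) t by blast
  qed
  show ?thesis
    unfolding sign_determined_def
  proof (intro exI[of _ A] conjI allI impI A(1,2))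
    fix x y assume "same_signs A x y"
    moreover have "same_signs A y x" using calculation by (auto simp: same_signs_def)
    ultimately show "(x \<in> {x. \<exists>t. x(n := t) \<in> S}) = (y \<in> {x. \<exists>t. x(n := t) \<in> S})"
      using imp by blast
  qed
qed

theorem sign_determined_projections:
  "sign_determined (coord_polys (n + k)) S \<Longrightarrow>
    sign_determined (coord_polys n) {x. \<exists>y\<in>S. \<forall>i<n. y i = x i}"
proof (induction k arbitrary: S)
  case 0
  then obtain B where B: "B \<subseteq> coord_polys n" "\<And>x y. same_signs B x y \<Longrightarrow> x \<in> S \<longleftrightarrow> y \<in> S"
    unfolding sign_determined_def by auto
  have "x \<in> S" if "y \<in> S" "\<forall>i<n. y i = x i" for x y
  proof -
    have "same_signs B x y"
      unfolding same_signs_def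
    proof
      fix b assume "b \<in> B"
      then have "b x = b y" using B(1) that(2) by (intro coord_polys_cong[of b n]) auto
      then show "sgn (b x) = sgn (b y)" by simp
    qed
    then show ?thesis using B(2) that(1) by blast
  qed
  then have "{x. \<exists>y\<in>S. \<forall>i<n. y i = x i} = S" by auto
  then show ?case using 0 by simp
next
  case (Suc k)
  let ?T = "{x. \<exists>t. x(n + k := t) \<in> S}"
  have "{x. \<exists>y\<in>S. \<forall>i<n. y i = x i} = {x. \<exists>y\<in>?T. \<forall>i<n. y i = x i}"
  proof (intro Collect_cong iffI)
    fix x assume "\<exists>y\<in>S. \<forall>i<n. y i = x i"
    then obtain y where y: "y \<in> S" "\<forall>i<n. y i = x i" by blast
    then have "y \<in> ?T" by (auto intro!: exI[of _ "y (n + k)"])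
    then show "\<exists>y\<in>?T. \<forall>i<n. y i = x i" using y(2) by blast
  next
    fix x assume "\<exists>y\<in>?T. \<forall>i<n. y i = x i"
    then obtain y t where y: "y(n + k := t) \<in> S" "\<forall>i<n. y i = x i" by blast
    then show "\<exists>y\<in>S. \<forall>i<n. y i = x i" by (intro bexI[of _ "y(n + k := t)"]) auto
  qed
  then show ?case using Suc.IH[OF sign_determined_projection] Suc.prems by simp
qed

section \<open>Roots and cells over a parameter\<close>

definition root_set :: "('x \<Rightarrow> real) list set \<Rightarrow> 'x \<Rightarrow> real set" where
  "root_set L x = {t. \<exists>f\<in>L. param_poly f x \<noteq> 0 \<and> poly (param_poly f x) t = 0}"

lemma finite_root_set:
  assumes "finite L" shows "finite (root_set L x)"
proof -
  have "root_set L x = (\<Union>f\<in>{f\<in>L. param_poly f x \<noteq> 0}. {t. poly (param_poly f x) t = 0})"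
    by (auto simp: root_set_def)
  then show ?thesis using assms by (auto intro: poly_roots_finite)
qed

lemma sign_iso_nonzero:
  assumes h: "sign_iso L x y h" and "f \<in> L"
  shows "param_poly f x \<noteq> 0 \<longleftrightarrow> param_poly f y \<noteq> 0"
proof -
  have eq: "poly (param_poly f x) t = 0 \<longleftrightarrow> poly (param_poly f y) (h t) = 0" for t
    using assms unfolding sign_iso_def by (metis sgn_0 sgn_zero_iff)
  have "surj h" using h by (auto simp: sign_iso_def order_iso_def)
  then have "(\<forall>t. poly (param_poly f x) t = 0) \<longleftrightarrow> (\<forall>u. poly (param_poly f y) u = 0)"
    using eq by (metis surjD)
  then show ?thesis by (simp add: poly_all_0_iff_0)
qed

lemma sign_iso_root:
  assumes h: "sign_iso L x y h"
  shows "h t \<in> root_set L y \<longleftrightarrow> t \<in> root_set L x"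
proof -
  have "poly (param_poly f x) t = 0 \<longleftrightarrow> poly (param_poly f y) (h t) = 0" if "f \<in> L" for f
    using assms that unfolding sign_iso_def by (metis sgn_0 sgn_zero_iff)
  then show ?thesis using sign_iso_nonzero[OF h] by (auto simp: root_set_def)
qed

lemma sign_iso_root_set:
  assumes h: "sign_iso L x y h"
  shows "root_set L y = h ` root_set L x"
proof -
  have "surj h" using h by (auto simp: sign_iso_def order_iso_def)
  then have "u \<in> h ` root_set L x" if "u \<in> root_set L y" for u
    using that sign_iso_root[OF h] by (metis imageI surjD)
  then show ?thesis using sign_iso_root[OF h] by blast
qed

lemma card_root_set_eq:
  assumes h: "sign_iso L x y h"
  shows "card (root_set L x) = card (root_set L y)"
  using h order_iso_eq[of h] unfolding sign_iso_root_set[OF h]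
  by (intro card_image[symmetric] inj_onI) (auto simp: sign_iso_def)

text \<open>
  The number of roots below \<open>t\<close>, together with the information whether \<open>t\<close> is a root, names the root or
  the gap that contains \<open>t\<close>.
\<close>
definition cell_index :: "('x \<Rightarrow> real) list set \<Rightarrow> 'x \<Rightarrow> real \<Rightarrow> nat \<times> bool" where
  "cell_index L x t = (card {r \<in> root_set L x. r < t}, t \<in> root_set L x)"

lemma sign_iso_cell_index:
  assumes h: "sign_iso L x y h"
  shows "cell_index L y (h t) = cell_index L x t"
proof -
  have iso: "order_iso h" using h by (simp add: sign_iso_def)
  have "{r \<in> root_set L y. r < h t} = h ` {r \<in> root_set L x. r < t}"
    using order_iso_less[OF iso] by (auto simp: sign_iso_root_set[OF h])
  moreover have "inj_on h {r \<in> root_set L x. r < t}"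
    using order_iso_eq[OF iso] by (auto intro: inj_onI)
  ultimately show ?thesis
    by (simp add: cell_index_def card_image sign_iso_root[OF h])
qed

lemma no_root_between:
  assumes "finite L" "cell_index L x s = cell_index L x t" "s < t" "s \<le> u" "u \<le> t"
  shows "u \<notin> root_set L x"
proof -
  let ?R = "root_set L x"
  have card: "card {r \<in> ?R. r < s} = card {r \<in> ?R. r < t}" and st: "s \<in> ?R \<longleftrightarrow> t \<in> ?R"
    using assms(2) by (auto simp: cell_index_def)
  have "{r \<in> ?R. r < s} = {r \<in> ?R. r < t}"
    using finite_root_set[OF assms(1), of x] assms(3) card by (intro card_subset_eq) auto
  then have *: "r < s" if "r \<in> ?R" "r < t" for r using that by blast
  then have "s \<notin> ?R" using assms(3) by blast
  then show ?thesis using * st assms(4,5) by (cases "u = t") force+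
qed

lemma cell_index_between:
  assumes "finite L" "cell_index L x s = cell_index L x t" "s \<le> u" "u \<le> t"
  shows "cell_index L x u = cell_index L x t"
proof (cases "s < t")
  case True
  have no: "r \<notin> root_set L x" if "s \<le> r" "r \<le> t" for r
    using no_root_between[OF assms(1,2) True that] .
  have "{r \<in> root_set L x. r < u} = {r \<in> root_set L x. r < t}"
  proof (intro Collect_cong conj_cong refl)
    fix r assume "r \<in> root_set L x"
    then have "r < s \<or> t < r" using no[of r] by linarith
    then show "r < u \<longleftrightarrow> r < t" using assms(3,4) by auto
  qed
  then show ?thesis using no[of u] no[of t] assms True by (simp add: cell_index_def)
next
  case False
  then have "u = t" using assms(3,4) by linarith
  then show ?thesis by simp
qed

lemma cell_index_sgn:
  assumes "finite L" "cell_index L x s = cell_index L x t" "f \<in> L"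
  shows "sgn (poly (param_poly f x) s) = sgn (poly (param_poly f x) t)"
proof -
  have *: "sgn (poly (param_poly f x) s) = sgn (poly (param_poly f x) t)"
    if "cell_index L x s = cell_index L x t" "s < t" for s t
  proof (cases "param_poly f x = 0")
    case False
    then show ?thesis
      using no_root_between[OF assms(1) that] assms(3) that(2)
      by (intro poly_sgn_eqI) (auto simp: root_set_def)
  qed simp
  show ?thesis
    using *[OF assms(2)] *[OF assms(2)[symmetric]] by (metis linorder_cases)
qed

text \<open>
  A root of multiplicity \<open>m\<close> is a simple root of the derivative of order \<open>m - 1\<close>.
\<close>
lemma simple_root_of_derivative:
  assumes closed: "\<And>f. f \<in> L \<Longrightarrow> deriv_coeffs f \<in> L"
    and "f \<in> L" "param_poly f x \<noteq> 0" "poly (param_poly f x) r = 0"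
  shows "\<exists>g\<in>L. poly (param_poly g x) r = 0 \<and> poly (pderiv (param_poly g x)) r \<noteq> 0"
  using assms(2-)
proof (induction "degree (param_poly f x)" arbitrary: f rule: less_induct)
  case less
  show ?case
  proof (cases "poly (pderiv (param_poly f x)) r = 0")
    case True
    have deg: "0 < degree (param_poly f x)"
    proof (rule ccontr)
      assume "\<not> ?thesis"
      then obtain c where "param_poly f x = [:c:]" by (auto elim: degree_eq_zeroE)
      then show False using less.prems(2,3) by simp
    qed
    then have "pderiv (param_poly f x) \<noteq> 0" by (simp add: pderiv_eq_0_iff)
    then show ?thesis
      using less.hyps[of "deriv_coeffs f"] less.prems(1) closed True deg
      by (simp add: param_poly_deriv_coeffs degree_pderiv)
  next
    case False
    then show ?thesis using less.prems by blast
  qed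
qed

lemma simple_root_sign_change:
  fixes p :: "real poly"
  assumes "poly p r = 0" "poly (pderiv p) r \<noteq> 0" "0 < e"
  shows "\<exists>a b. r - e < a \<and> a < b \<and> b < r + e \<and> poly p a * poly p b < 0"
proof -
  have *: "\<exists>a b. r - e < a \<and> a < b \<and> b < r + e \<and> poly p a < 0 \<and> 0 < poly p b"
    if p: "poly p r = 0" "poly (pderiv p) r > 0" for p
  proof -
    obtain d1 where d1: "d1 > 0" "\<And>h. 0 < h \<Longrightarrow> h < d1 \<Longrightarrow> poly p (r - h) < poly p r"
      using DERIV_pos_inc_left[OF poly_DERIV p(2)] by blast
    obtain d2 where d2: "d2 > 0" "\<And>h. 0 < h \<Longrightarrow> h < d2 \<Longrightarrow> poly p r < poly p (r + h)"
      using DERIV_pos_inc_right[OF poly_DERIV p(2)] by blast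
    define h where "h = min e (min d1 d2) / 2"
    have h: "0 < h" "h < e" "h < d1" "h < d2" using d1(1) d2(1) assms(3) by (auto simp: h_def)
    show ?thesis
      using h d1(2)[OF h(1,3)] d2(2)[OF h(1,4)] p(1)
      by (intro exI[of _ "r - h"] exI[of _ "r + h"]) auto
  qed
  show ?thesis
  proof (cases "poly (pderiv p) r > 0")
    case True
    then show ?thesis using *[of p] assms(1) mult_neg_pos by metis
  next
    case False
    then have "poly (pderiv (- p)) r > 0" using assms(2) by (simp add: pderiv_minus)
    then obtain a b where "r - e < a" "a < b" "b < r + e" "poly p a > 0" "poly p b < 0"
      using *[of "- p"] assms(1) by auto
    then show ?thesis using mult_pos_neg by blast
  qed
qed

lemma continuous_on_poly_param_poly:
  fixes f :: "('x::topological_space \<Rightarrow> real) list"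
  shows "(\<And>c. c \<in> set f \<Longrightarrow> continuous_on UNIV c) \<Longrightarrow> continuous_on UNIV (\<lambda>x. poly (param_poly f x) t)"
  by (induction f) (auto simp: poly_monom intro!: continuous_intros)

text \<open>
  At a simple root the polynomial changes sign, and a sign change between two fixed points is
  stable under small changes of the coefficients.
\<close>
lemma root_persists:
  fixes L :: "('x::topological_space \<Rightarrow> real) list set"
  assumes closed: "\<And>f. f \<in> L \<Longrightarrow> deriv_coeffs f \<in> L"
    and cont: "\<And>f c. f \<in> L \<Longrightarrow> c \<in> set f \<Longrightarrow> continuous_on UNIV c"
    and r: "r \<in> root_set L x" and "0 < e"
  shows "\<forall>\<^sub>F y in at x within A. \<exists>w\<in>root_set L y. \<bar>w - r\<bar> < e"
proof -
  obtain f where "f \<in> L" "param_poly f x \<noteq> 0" "poly (param_poly f x) r = 0"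
    using r by (auto simp: root_set_def)
  then obtain g where g: "g \<in> L" "poly (param_poly g x) r = 0" "poly (pderiv (param_poly g x)) r \<noteq> 0"
    using simple_root_of_derivative[OF closed] by blast
  obtain a b where ab: "r - e < a" "a < b" "b < r + e"
      "poly (param_poly g x) a * poly (param_poly g x) b < 0"
    using simple_root_sign_change[OF g(2,3) \<open>0 < e\<close>] by blast
  have "continuous_on UNIV (\<lambda>y. poly (param_poly g y) a * poly (param_poly g y) b)"
    using cont[OF g(1)] by (intro continuous_on_mult continuous_on_poly_param_poly)
  then have "((\<lambda>y. poly (param_poly g y) a * poly (param_poly g y) b) \<longlongrightarrow>
      poly (param_poly g x) a * poly (param_poly g x) b) (at x within A)"
    by (meson UNIV_I continuous_on_def subset_UNIV tendsto_within_subset)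
  then have "\<forall>\<^sub>F y in at x within A. poly (param_poly g y) a * poly (param_poly g y) b < 0"
    using ab(4) by (rule order_tendstoD)
  then show ?thesis
  proof (rule eventually_mono)
    fix y assume neg: "poly (param_poly g y) a * poly (param_poly g y) b < 0"
    then obtain w where "a < w" "w < b" "poly (param_poly g y) w = 0"
      using poly_IVT[OF ab(2) neg] by blast
    moreover have "param_poly g y \<noteq> 0" using neg by auto
    ultimately show "\<exists>w\<in>root_set L y. \<bar>w - r\<bar> < e"
      using g(1) ab by (intro bexI[of _ w]) (auto simp: root_set_def)
  qed
qed

lemma finite_separated:
  fixes Z :: "real set"
  assumes "finite Z"
  shows "\<exists>d>0. \<forall>r\<in>Z. \<forall>r'\<in>Z. r < r' \<longrightarrow> d \<le> r' - r"
proof -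
  define D where "D = insert 1 {r' - r | r r'. r \<in> Z \<and> r' \<in> Z \<and> r < r'}"
  have "{r' - r | r r'. r \<in> Z \<and> r' \<in> Z \<and> r < r'} \<subseteq> (\<lambda>(r, r'). r' - r) ` (Z \<times> Z)" by auto
  then have "finite {r' - r | r r'. r \<in> Z \<and> r' \<in> Z \<and> r < r'}"
    by (rule finite_subset) (use assms in simp)
  then have fin: "finite D" by (simp add: D_def)
  have "0 < Min D" using fin by (subst Min_gr_iff) (auto simp: D_def)
  moreover have "\<forall>r\<in>Z. \<forall>r'\<in>Z. r < r' \<longrightarrow> Min D \<le> r' - r"
    using fin by (auto intro!: Min_le simp: D_def)
  ultimately show ?thesis by blast
qed

definition nth_root :: "('x \<Rightarrow> real) list set \<Rightarrow> nat \<Rightarrow> 'x \<Rightarrow> real" where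
  "nth_root L j x = sorted_list_of_set (root_set L x) ! j"

text \<open>
  Disjoint small intervals around the roots at \<open>x\<close> each contain a root at every nearby \<open>y\<close>. As the number
  of roots is the same, each contains exactly one, and so the order of the roots is preserved.
\<close>
lemma continuous_on_nth_root:
  fixes L :: "('x::topological_space \<Rightarrow> real) list set"
  assumes fin: "finite L" and closed: "\<And>f. f \<in> L \<Longrightarrow> deriv_coeffs f \<in> L"
    and cont: "\<And>f c. f \<in> L \<Longrightarrow> c \<in> set f \<Longrightarrow> continuous_on UNIV c"
    and card: "\<And>x. x \<in> A \<Longrightarrow> card (root_set L x) = n" and "j < n"
  shows "continuous_on A (nth_root L j)"
  unfolding continuous_on_def
proof (intro ballI tendstoI)
  fix x \<epsilon> assume x: "x \<in> A" and "0 < (\<epsilon>::real)"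
  let ?R = "root_set L x"
  have finR: "finite (root_set L y)" for y using fin by (rule finite_root_set)
  obtain d where d: "d > 0" "\<And>r r'. r \<in> ?R \<Longrightarrow> r' \<in> ?R \<Longrightarrow> r < r' \<Longrightarrow> d \<le> r' - r"
    using finite_separated[OF finR] by blast
  define e where "e = min \<epsilon> (d / 2)"
  have e: "0 < e" "e \<le> \<epsilon>" "2 * e \<le> d" using d(1) \<open>0 < \<epsilon>\<close> by (auto simp: e_def)
  have "\<forall>\<^sub>F y in at x within A. \<forall>r\<in>?R. \<exists>w\<in>root_set L y. \<bar>w - r\<bar> < e"
    using root_persists[OF closed cont] e(1) finR by (simp add: eventually_ball_finite)
  moreover have "\<forall>\<^sub>F y in at x within A. y \<in> A"
    by (simp add: eventually_at_filter)
  ultimately show "\<forall>\<^sub>F y in at x within A. dist (nth_root L j y) (nth_root L j x) < \<epsilon>"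
  proof eventually_elim
    case (elim y)
    obtain w where w: "\<And>r. r \<in> ?R \<Longrightarrow> w r \<in> root_set L y" "\<And>r. r \<in> ?R \<Longrightarrow> \<bar>w r - r\<bar> < e"
      using elim(1) by metis
    have mono: "w r < w r'" if "r \<in> ?R" "r' \<in> ?R" "r < r'" for r r'
      using w(2)[OF that(1)] w(2)[OF that(2)] d(2)[OF that] e(3) by linarith
    define zs where "zs = sorted_list_of_set ?R"
    have zs: "set zs = ?R" "sorted_wrt (<) zs" "length zs = n"
      using finR card[OF x] by (auto simp: zs_def strict_sorted_list_of_set)
    have sorted: "sorted_wrt (<) (map w zs)"
      unfolding sorted_wrt_map
      by (rule sorted_wrt_mono_rel[OF _ zs(2)]) (use mono zs(1) in auto)
    then have dist: "card (w ` ?R) = n"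
      using zs by (metis distinct_card length_map set_map strict_sorted_iff)
    have "w ` ?R = root_set L y"
      using w(1) dist card[OF elim(2)] by (intro card_subset_eq finR) auto
    then have "sorted_list_of_set (root_set L y) = map w zs"
      using sorted zs(1) finR[of y]
      by (intro strict_sorted_equal) (auto simp: strict_sorted_list_of_set)
    then have "nth_root L j y = w (nth_root L j x)"
      using \<open>j < n\<close> zs(3) by (simp add: nth_root_def zs_def)
    moreover have "nth_root L j x \<in> ?R"
      using \<open>j < n\<close> zs nth_mem[of j zs] by (simp add: nth_root_def zs_def)
    ultimately show ?case using w(2)[of "nth_root L j x"] e(2) by (simp add: dist_real_def)
  qed
qed

lemma card_less_sorted:
  fixes zs :: "real list"
  assumes "sorted_wrt (<) zs" "j \<le> length zs"
    and "\<And>i. i < j \<Longrightarrow> zs ! i < t" "\<And>i. j \<le> i \<Longrightarrow> i < length zs \<Longrightarrow> t \<le> zs ! i"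
  shows "card {r \<in> set zs. r < t} = j"
proof -
  have "{r \<in> set zs. r < t} = (!) zs ` {..<j}"
  proof (intro equalityI subsetI)
    fix r assume r: "r \<in> {r \<in> set zs. r < t}"
    then obtain i where i: "i < length zs" "r = zs ! i" by (auto simp: in_set_conv_nth)
    then have "i < j" using assms(4)[of i] r by force
    then show "r \<in> (!) zs ` {..<j}" using i by blast
  next
    fix r assume "r \<in> (!) zs ` {..<j}"
    then show "r \<in> {r \<in> set zs. r < t}" using assms(2,3) by auto
  qed
  moreover have "inj_on ((!) zs) {..<j}"
    using assms(1,2) by (intro inj_onI) (auto simp: strict_sorted_iff nth_eq_iff_index_eq)
  ultimately show ?thesis by (simp add: card_image)
qed

text \<open>
  A continuous choice of a point in each fibre of a cell: the root itself, the midpoint of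
  two neighbouring roots, a point at distance one beyond the extreme root on either side, or \<open>0\<close> if
  there are no roots.
\<close>
lemma cell_section:
  fixes L :: "('x::topological_space \<Rightarrow> real) list set"
  assumes fin: "finite L" and closed: "\<And>f. f \<in> L \<Longrightarrow> deriv_coeffs f \<in> L"
    and cont: "\<And>f c. f \<in> L \<Longrightarrow> c \<in> set f \<Longrightarrow> continuous_on UNIV c"
    and card: "\<And>x. x \<in> A \<Longrightarrow> card (root_set L x) = n"
    and k: "x \<in> A" "cell_index L x t = k"
  shows "\<exists>s. continuous_on A s \<and> (\<forall>x\<in>A. cell_index L x (s x) = k)"
proof -
  obtain j b where jb: "k = (j, b)" by fastforce
  define zs where "zs = (\<lambda>x. sorted_list_of_set (root_set L x))"
  have finR: "finite (root_set L y)" for y using fin by (rule finite_root_set)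
  have zs: "set (zs x) = root_set L x" "sorted_wrt (<) (zs x)" "x \<in> A \<Longrightarrow> length (zs x) = n" for x
    using finR card[of x] by (auto simp: zs_def strict_sorted_list_of_set)
  have less: "zs x ! i < zs x ! i'" if "x \<in> A" "i < i'" "i' < n" for x i i'
    using zs that by (simp add: sorted_wrt_iff_nth_less)
  have root: "continuous_on A (\<lambda>x. zs x ! i)" if "i < n" for i
    using continuous_on_nth_root[OF fin closed cont card that] by (simp add: nth_root_def zs_def)
  have j: "j = card {r \<in> root_set L x. r < t}" "b \<longleftrightarrow> t \<in> root_set L x"
    using k(2) jb by (auto simp: cell_index_def)
  have "j \<le> n" unfolding j card[OF k(1), symmetric] by (intro card_mono finR) auto
  have index: "cell_index L x t = (j, b)"
    if a: "x \<in> A" "\<And>i. i < j \<Longrightarrow> zs x ! i < t" "\<And>i. j \<le> i \<Longrightarrow> i < n \<Longrightarrow> t \<le> zs x ! i"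
      "b \<longleftrightarrow> j < n \<and> t = zs x ! j" for x t
  proof -
    have "card {r \<in> root_set L x. r < t} = j"
      using card_less_sorted[OF zs(2), of j x t] a(2,3) zs(1,3) a(1) \<open>j \<le> n\<close> by auto
    moreover have "t \<in> root_set L x \<longleftrightarrow> j < n \<and> t = zs x ! j"
    proof
      assume "t \<in> root_set L x"
      then have "t \<in> set (zs x)" by (simp add: zs(1))
      then obtain i where i: "i < n" "t = zs x ! i"
        using zs(3)[OF a(1)] by (auto simp: in_set_conv_nth)
      then have "j \<le> i" using a(2)[of i] by (cases "i < j") auto
      have "\<not> j < i"
      proof
        assume "j < i"
        then show False using a(3)[of j] less[OF a(1), of j i] i by simp
      qed
      with \<open>j \<le> i\<close> have "i = j" by linarith
      then show "j < n \<and> t = zs x ! j" using i by simp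
    next
      assume "j < n \<and> t = zs x ! j"
      then show "t \<in> root_set L x"
        using nth_mem[of j "zs x"] zs(3)[OF a(1)] by (simp add: zs(1))
    qed
    ultimately show ?thesis using a(4) by (simp add: cell_index_def)
  qed
  show ?thesis
  proof (cases b)
    case True
    have "j < n"
    proof -
      have "card {r \<in> root_set L x. r < t} < card (root_set L x)"
        using j(2) True by (intro psubset_card_mono finR) auto
      then show ?thesis using j(1) card[OF k(1)] by simp
    qed
    then show ?thesis unfolding jb
      using root[of j] less True
      by (intro exI[of _ "\<lambda>x. zs x ! j"] conjI ballI index) (auto simp: le_less)
  next
    case False
    consider "n = 0" | "j = 0" "0 < n" | "j = n" "0 < n" | "0 < j" "j < n" using \<open>j \<le> n\<close> by linarith
    then show ?thesis unfolding jb
    proof cases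
      case 1
      then show "\<exists>s. continuous_on A s \<and> (\<forall>x\<in>A. cell_index L x (s x) = (j, b))"
        using False \<open>j \<le> n\<close> by (intro exI[of _ "\<lambda>x. 0"] conjI ballI index) auto
    next
      case 2
      have "zs x ! 0 - 1 \<le> zs x ! i" if "x \<in> A" "i < n" for x i
        using less[OF that(1), of 0 i] that(2) by (cases "i = 0") auto
      then show "\<exists>s. continuous_on A s \<and> (\<forall>x\<in>A. cell_index L x (s x) = (j, b))"
        using 2 False root[of 0]
        by (intro exI[of _ "\<lambda>x. zs x ! 0 - 1"] conjI ballI index) (auto intro!: continuous_intros)
    next
      case 3
      have "zs x ! i < zs x ! (n - 1) + 1" if "x \<in> A" "i < n" for x i
      proof -
        have "i < n - 1 \<or> i = n - 1" using that(2) by linarith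
        then show ?thesis using less[OF that(1), of i "n - 1"] 3(2) by force
      qed
      then show "\<exists>s. continuous_on A s \<and> (\<forall>x\<in>A. cell_index L x (s x) = (j, b))"
        using 3 False root[of "n - 1"]
        by (intro exI[of _ "\<lambda>x. zs x ! (n - 1) + 1"] conjI ballI index) (auto intro!: continuous_intros)
    next
      case 4
      define s where "s = (\<lambda>x. (zs x ! (j - 1) + zs x ! j) / 2)"
      have s: "zs x ! (j - 1) < s x" "s x < zs x ! j" if "x \<in> A" for x
        using less[OF that, of "j - 1" j] 4 by (auto simp: s_def)
      have "zs x ! i < s x" if "x \<in> A" "i < j" for x i
      proof -
        have "i < j - 1 \<or> i = j - 1" using that(2) by linarith
        then show ?thesis using less[OF that(1), of i "j - 1"] s(1)[OF that(1)] 4 by force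
      qed
      moreover have "s x \<le> zs x ! i" if "x \<in> A" "j \<le> i" "i < n" for x i
      proof -
        have "j < i \<or> i = j" using that(2) by linarith
        then show ?thesis using less[OF that(1), of j i] that(3) s(2)[OF that(1)] by force
      qed
      moreover have "continuous_on A s"
        unfolding s_def using root 4 by (auto intro!: continuous_intros)
      ultimately show "\<exists>s. continuous_on A s \<and> (\<forall>x\<in>A. cell_index L x (s x) = (j, b))"
        using False s(2) by (intro exI[of _ s] conjI ballI index) force+
    qed
  qed
qed

section \<open>Decomposition into finitely many path-connected sets\<close>

lemma continuous_on_fun_upd:
  fixes f :: "'x::topological_space \<Rightarrow> 'i \<Rightarrow> real"
  assumes "continuous_on A f" "continuous_on A s"
  shows "continuous_on A (\<lambda>x. (f x)(i := s x))"
proof (rule continuous_on_coordinatewise_then_product)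
  fix k
  show "continuous_on A (\<lambda>x. ((f x)(i := s x)) k)"
    using assms(2) continuous_on_product_then_coordinatewise[OF assms(1), of k] by (cases "k = i") auto
qed

text \<open>
  Any two points are joined by moving vertically to the section \<open>s\<close>, along its graph, and vertically
  again.
\<close>
lemma path_connected_cylinder_cell:
  fixes A :: "('i \<Rightarrow> real) set"
  assumes "path_connected A" and s: "continuous_on A s" "\<And>x. x \<in> A \<Longrightarrow> s x \<in> I x"
    and "\<And>x. x \<in> A \<Longrightarrow> is_interval (I x)"
  shows "path_connected {x(i := t) |x t. x \<in> A \<and> t \<in> I x}"
proof (cases "A = {}")
  case False
  then obtain x0 where "x0 \<in> A" by blast
  define G where "G = (\<lambda>x. x(i := s x)) ` A"
  define V where "V = (\<lambda>x. (\<lambda>t. x(i := t)) ` I x)"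
  have "path_connected G"
    unfolding G_def using assms(1) s(1)
    by (intro path_connected_continuous_image continuous_on_fun_upd continuous_on_id)
  moreover have "path_connected (V x)" if "x \<in> A" for x
    unfolding V_def using assms(4)[OF that]
    by (intro path_connected_continuous_image continuous_on_fun_upd continuous_on_const continuous_on_id
        is_interval_path_connected)
  moreover have "G \<inter> V x \<noteq> {}" if "x \<in> A" for x
    using that s(2) by (auto simp: G_def V_def)
  ultimately have "path_connected (G \<union> V x)" if "x \<in> A" for x
    using that path_connected_Un by blast
  then have "path_connected (\<Union>x\<in>A. G \<union> V x)"
    by (rule path_connected_UNION[where z = "x0(i := s x0)"]) (use \<open>x0 \<in> A\<close> in \<open>auto simp: G_def\<close>)
  moreover have "(\<Union>x\<in>A. G \<union> V x) = {x(i := t) |x t. x \<in> A \<and> t \<in> I x}"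
    using s(2) by (auto simp: G_def V_def)
  ultimately show ?thesis by simp
qed simp

definition finitely_path_connected :: "'a::topological_space set \<Rightarrow> bool" where
  "finitely_path_connected S \<longleftrightarrow> (\<exists>F. finite F \<and> (\<forall>C\<in>F. path_connected C) \<and> S = \<Union>F)"

lemma path_connected_UNIV_fun: "path_connected (UNIV :: ('i \<Rightarrow> real) set)"
  unfolding path_connected_def
proof (intro ballI)
  fix x y :: "'i \<Rightarrow> real"
  let ?g = "\<lambda>s i. (1 - s) * x i + s * y i"
  have "path ?g"
    unfolding path_def by (intro continuous_on_coordinatewise_then_product continuous_intros)
  moreover have "pathstart ?g = x" "pathfinish ?g = y"
    by (auto simp: pathstart_def pathfinish_def)
  ultimately show "\<exists>g. path g \<and> path_image g \<subseteq> UNIV \<and> pathstart g = x \<and> pathfinish g = y"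
    by blast
qed

lemma deriv_closure:
  assumes R: "function_ring R" and "finite L" "\<forall>f\<in>L. set f \<subseteq> R"
  shows "\<exists>L'. finite L' \<and> L \<subseteq> L' \<and> (\<forall>f\<in>L'. set f \<subseteq> R) \<and> (\<forall>f\<in>L'. deriv_coeffs f \<in> L')"
proof -
  define L' where "L' = (\<Union>f\<in>L. (\<lambda>k. (deriv_coeffs ^^ k) f) ` {..length f})"
  have len: "length ((deriv_coeffs ^^ k) f) = length f - k" for k and f :: "('a \<Rightarrow> real) list"
    by (induction k) (auto simp: length_deriv_coeffs)
  have sub: "set ((deriv_coeffs ^^ k) f) \<subseteq> R" if "set f \<subseteq> R" for k f
    using that by (induction k) (auto dest: set_deriv_coeffs[OF R])
  have "deriv_coeffs g \<in> L'" if g: "g \<in> L'" for g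
  proof -
    obtain f k where f: "f \<in> L" "k \<le> length f" "g = (deriv_coeffs ^^ k) f"
      using g by (auto simp: L'_def)
    show ?thesis
    proof (cases "k = length f")
      case True
      then have "g = []" using len[of k f] f(3) by simp
      then show ?thesis using g by simp
    next
      case False
      then have "Suc k \<le> length f" using f(2) by simp
      then have "(deriv_coeffs ^^ Suc k) f \<in> L'" using f(1) unfolding L'_def by blast
      then show ?thesis using f(3) by simp
    qed
  qed
  moreover have "L \<subseteq> L'" by (force simp: L'_def)
  moreover have "\<forall>f\<in>L'. set f \<subseteq> R" using assms(3) sub by (auto simp: L'_def)
  moreover have "finite L'" using assms(2) by (simp add: L'_def)
  ultimately show ?thesis by blast
qed

lemma finite_same_signs_cover:
  fixes R :: "('x::topological_space \<Rightarrow> real) set"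
  assumes A: "finite A" "A \<subseteq> R"
    and fpc: "\<And>S. sign_determined R S \<Longrightarrow> finitely_path_connected S"
  shows "\<exists>F. finite F \<and> \<Union>F = UNIV \<and> (\<forall>C\<in>F. path_connected C \<and> (\<forall>x\<in>C. \<forall>y\<in>C. same_signs A x y))"
proof -
  define Sgn where "Sgn = PiE A (\<lambda>_. {-1, 0, 1::real})"
  define cls where "cls = (\<lambda>\<sigma>. {x. \<forall>b\<in>A. sgn (b x) = \<sigma> b})"
  have "sign_determined R (cls \<sigma>)" for \<sigma>
    unfolding sign_determined_def using A
    by (intro exI[of _ A]) (auto simp: same_signs_def cls_def)
  then have "\<forall>\<sigma>. \<exists>F. finite F \<and> (\<forall>C\<in>F. path_connected C) \<and> cls \<sigma> = \<Union>F"
    using fpc unfolding finitely_path_connected_def by blast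
  then obtain F where F: "\<And>\<sigma>. finite (F \<sigma>)" "\<And>\<sigma> C. C \<in> F \<sigma> \<Longrightarrow> path_connected C" "\<And>\<sigma>. cls \<sigma> = \<Union>(F \<sigma>)"
    by metis
  show ?thesis
  proof (intro exI[of _ "\<Union>\<sigma>\<in>Sgn. F \<sigma>"] conjI ballI)
    show "finite (\<Union>\<sigma>\<in>Sgn. F \<sigma>)" using F(1) A(1) by (auto simp: Sgn_def intro!: finite_PiE)
    have "x \<in> cls (restrict (\<lambda>b. sgn (b x)) A)" "restrict (\<lambda>b. sgn (b x)) A \<in> Sgn" for x
      by (auto simp: cls_def Sgn_def sgn_if)
    then have "\<exists>\<sigma>\<in>Sgn. x \<in> \<Union>(F \<sigma>)" for x unfolding F(3)[symmetric] by blast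
    then show "\<Union>(\<Union>\<sigma>\<in>Sgn. F \<sigma>) = UNIV" by auto
  next
    fix C assume "C \<in> (\<Union>\<sigma>\<in>Sgn. F \<sigma>)"
    then obtain \<sigma> where "C \<in> F \<sigma>" by blast
    then show "path_connected C" using F(2) by blast
    fix x y assume "x \<in> C" "y \<in> C"
    then have "x \<in> cls \<sigma>" "y \<in> cls \<sigma>" using \<open>C \<in> F \<sigma>\<close> F(3) by auto
    then show "same_signs A x y" by (simp add: cls_def same_signs_def)
  qed
qed

text \<open>
  By induction the parameter space is a finite union of path-connected sets \<open>C\<close> on each of which the
  sign pattern is constant. Over each \<open>C\<close> there are finitely many cells, each path connected and
  either contained in \<open>S\<close> or disjoint from it.
\<close>
theorem sign_determined_finitely_path_connected:
  "sign_determined (coord_polys n) S \<Longrightarrow> finitely_path_connected S"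
proof (induction n arbitrary: S)
  case 0
  then obtain B where B: "B \<subseteq> coord_polys 0" "\<And>x y. same_signs B x y \<Longrightarrow> x \<in> S \<longleftrightarrow> y \<in> S"
    unfolding sign_determined_def by blast
  have "same_signs B x y" for x y
    unfolding same_signs_def
  proof
    fix b assume "b \<in> B"
    then have "b x = b y" using B(1) by (intro coord_polys_cong[of b 0]) auto
    then show "sgn (b x) = sgn (b y)" by simp
  qed
  then have "S = {} \<or> S = UNIV" using B(2) by blast
  then show ?case
    unfolding finitely_path_connected_def
    by (intro exI[of _ "{S}"]) (auto intro: path_connected_UNIV_fun)
next
  case (Suc n)
  obtain B where B: "finite B" "B \<subseteq> coord_polys (Suc n)" "\<And>x y. same_signs B x y \<Longrightarrow> x \<in> S \<longleftrightarrow> y \<in> S"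
    using Suc.prems unfolding sign_determined_def by metis
  obtain L0 where L0: "finite L0" "\<forall>f\<in>L0. set f \<subseteq> coord_polys n"
      "\<And>b. b \<in> B \<Longrightarrow> \<exists>f\<in>L0. \<forall>x t. b (x(n := t)) = poly (param_poly f x) t"
    using coord_polys_coeff_lists[OF B(1,2)] by metis
  obtain L where L: "finite L" "L0 \<subseteq> L" "\<forall>f\<in>L. set f \<subseteq> coord_polys n" "\<And>f. f \<in> L \<Longrightarrow> deriv_coeffs f \<in> L"
    using deriv_closure[OF function_ring_coord_polys L0(1,2)] by metis
  have cont: "continuous_on UNIV c" if "f \<in> L" "c \<in> set f" for f c
    using L(3) that coord_polys_continuous by blast
  obtain A where A: "finite A" "A \<subseteq> coord_polys n" "\<And>x y. same_signs A x y \<Longrightarrow> \<exists>h. sign_iso L x y h"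
    using sign_iso_of_same_signs_set[OF function_ring_coord_polys L(1,3)] by metis
  obtain F where F: "finite F" "\<Union>F = UNIV" "\<And>C. C \<in> F \<Longrightarrow> path_connected C"
      "\<And>C x y. C \<in> F \<Longrightarrow> x \<in> C \<Longrightarrow> y \<in> C \<Longrightarrow> \<exists>h. sign_iso L x y h"
    using finite_same_signs_cover[OF A(1,2) Suc.IH] A(3) by metis
  \<comment> \<open>Coordinate \<open>n\<close> of the base point is overwritten, so \<open>C\<close> need not be a cylinder in that direction.\<close>
  define cell where "cell = (\<lambda>C k. {x(n := t) |x t. x \<in> C \<and> t \<in> {t. cell_index L x t = k}})"
  define keys where "keys = (\<lambda>C. {cell_index L x t |x t. x \<in> C})"
  have fin: "finite (keys C)" if "C \<in> F" for C
  proof (cases "C = {}")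
    case False
    then obtain x0 where x0: "x0 \<in> C" by blast
    have "keys C \<subseteq> {..card (root_set L x0)} \<times> UNIV"
    proof -
      have "card {r \<in> root_set L x. r < t} \<le> card (root_set L x0)" if xC: "x \<in> C" for x t
      proof -
        have "card {r \<in> root_set L x. r < t} \<le> card (root_set L x)"
          by (intro card_mono finite_root_set L(1)) auto
        moreover obtain h where "sign_iso L x x0 h" using F(4)[OF \<open>C \<in> F\<close> xC x0] by blast
        ultimately show ?thesis using card_root_set_eq by fastforce
      qed
      then show ?thesis by (auto simp: keys_def cell_index_def)
    qed
    then show ?thesis by (rule finite_subset) auto
  qed (simp add: keys_def)
  have pc: "path_connected (cell C k)" if C: "C \<in> F" "k \<in> keys C" for C k
  proof -
    obtain x t where xt: "x \<in> C" "cell_index L x t = k" using C(2) by (auto simp: keys_def)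
    have card: "card (root_set L y) = card (root_set L x)" if "y \<in> C" for y
      using F(4)[OF C(1) that xt(1)] by (elim exE) (rule card_root_set_eq)
    have "\<exists>s. continuous_on C s \<and> (\<forall>x\<in>C. cell_index L x (s x) = k)"
      by (rule cell_section[OF L(1,4) cont card xt])
    then obtain s where s: "continuous_on C s" "\<And>x. x \<in> C \<Longrightarrow> cell_index L x (s x) = k"
      by blast
    show ?thesis
      unfolding cell_def
    proof (rule path_connected_cylinder_cell[OF F(3)[OF C(1)] s(1),
          where I = "\<lambda>x. {t. cell_index L x t = k}"])
      show "is_interval {t. cell_index L x t = k}" for x
        unfolding is_interval_1
      proof (intro ballI allI impI)
        fix a b u assume *: "a \<in> {t. cell_index L x t = k}" "b \<in> {t. cell_index L x t = k}" "a \<le> u \<and> u \<le> b"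
        then have "cell_index L x a = cell_index L x b" by simp
        from cell_index_between[OF L(1) this, of u] *(2,3)
        show "u \<in> {t. cell_index L x t = k}" by simp
      qed
    qed (use s(2) in auto)
  qed
  have sub: "cell C k \<subseteq> S"
    if C: "C \<in> F" "x \<in> C" "cell_index L x t = k" "x(n := t) \<in> S" for C k x t
  proof
    fix z assume "z \<in> cell C k"
    then obtain y u where yu: "z = y(n := u)" "y \<in> C" "cell_index L y u = k" by (auto simp: cell_def)
    obtain h where h: "sign_iso L x y h" using F(4)[OF C(1,2) yu(2)] by blast
    have idx: "cell_index L y (h t) = cell_index L y u"
      using sign_iso_cell_index[OF h] C(3) yu(3) by simp
    have "same_signs B (x(n := t)) z"
      unfolding same_signs_def
    proof
      fix b assume "b \<in> B"
      then obtain f where f: "f \<in> L" "\<And>x t. b (x(n := t)) = poly (param_poly f x) t"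
        using L0(3)[OF \<open>b \<in> B\<close>] L(2) by blast
      have "sgn (b (x(n := t))) = sgn (poly (param_poly f y) (h t))"
        using h f by (simp add: sign_iso_def)
      also have "\<dots> = sgn (b z)" unfolding yu(1) f(2) using cell_index_sgn[OF L(1) idx f(1)] .
      finally show "sgn (b (x(n := t))) = sgn (b z)" .
    qed
    then show "z \<in> S" using B(3) C(4) by blast
  qed
  show ?case
    unfolding finitely_path_connected_def
  proof (intro exI[of _ "{D \<in> \<Union>C\<in>F. cell C ` keys C. D \<subseteq> S}"] conjI ballI)
    show "finite {D \<in> \<Union>C\<in>F. cell C ` keys C. D \<subseteq> S}"
      using fin F(1) by auto
    show "path_connected D" if "D \<in> {D \<in> \<Union>C\<in>F. cell C ` keys C. D \<subseteq> S}" for D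
      using that pc by auto
    show "S = \<Union>{D \<in> \<Union>C\<in>F. cell C ` keys C. D \<subseteq> S}"
    proof (intro equalityI subsetI)
      fix x assume x: "x \<in> S"
      have "x \<in> \<Union>F" by (simp add: F(2))
      then obtain C where C: "C \<in> F" "x \<in> C" by (rule UnionE)
      define k where "k = cell_index L x (x n)"
      have "cell C k \<subseteq> S" using sub[OF C, of "x n" k] x by (simp add: k_def)
      moreover have "k \<in> keys C" using C(2) by (auto simp: k_def keys_def)
      moreover have "x \<in> cell C k"
        unfolding cell_def using C(2)
        by (intro CollectI exI[of _ x] exI[of _ "x n"]) (auto simp: k_def)
      ultimately show "x \<in> \<Union>{D \<in> \<Union>C\<in>F. cell C ` keys C. D \<subseteq> S}" using C(1) by blast
    qed auto
  qed
qed

section \<open>Components of locally finitely path-connected sets\<close>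

lemma finitely_path_connectedE:
  assumes "finitely_path_connected S"
  obtains F where "finite F" "\<And>C. C \<in> F \<Longrightarrow> path_connected C" "S = \<Union>F"
proof -
  obtain F where "finite F \<and> (\<forall>C\<in>F. path_connected C) \<and> S = \<Union>F"
    using assms unfolding finitely_path_connected_def by (elim exE)
  then show thesis by (intro that[of F]) auto
qed

lemma continuous_on_concatenated_paths:
  fixes p :: "nat \<Rightarrow> real \<Rightarrow> 'a::topological_space"
  assumes path: "\<And>k. path (p k)" and link: "\<And>k. pathfinish (p k) = pathstart (p (Suc k))"
  shows "continuous_on {0..real n} (\<lambda>t. p (nat \<lfloor>t\<rfloor>) (frac t))"
proof (induction n)
  case (Suc n)
  let ?g = "\<lambda>t. p (nat \<lfloor>t\<rfloor>) (frac t)"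
  have eq: "?g t = p n (t - real n)" if "t \<in> {real n..real (Suc n)}" for t
  proof (cases "t = real (Suc n)")
    case True
    have "\<lfloor>t\<rfloor> = int (Suc n)" unfolding True by (rule floor_of_nat)
    then have *: "nat \<lfloor>t\<rfloor> = Suc n" "frac t = 0" "t - real n = 1" using True by (simp_all add: frac_def)
    show ?thesis unfolding * using link[of n] by (simp add: pathstart_def pathfinish_def)
  next
    case False
    then have "\<lfloor>t\<rfloor> = int n" using that by (intro floor_unique) auto
    then show ?thesis by (simp add: frac_def)
  qed
  have "continuous_on {real n..real (Suc n)} (\<lambda>t. p n (t - real n))"
    by (rule continuous_on_compose2[OF path[unfolded path_def]]) (auto intro!: continuous_intros)
  moreover have "continuous_on {real n..real (Suc n)} ?g \<longleftrightarrow>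
      continuous_on {real n..real (Suc n)} (\<lambda>t. p n (t - real n))"
    using eq by (intro continuous_on_cong refl)
  ultimately have "continuous_on {real n..real (Suc n)} ?g" by simp
  then have "continuous_on ({0..real n} \<union> {real n..real (Suc n)}) ?g"
    using Suc by (intro continuous_on_closed_Un) auto
  moreover have "{0..real n} \<union> {real n..real (Suc n)} = {0..real (Suc n)}" by auto
  ultimately show ?case by metis
qed simp

text \<open>
  The infinitely many paths are run through on the intervals \<open>[k, k + 1]\<close>, and \<open>[0, \<infinity>)\<close> is mapped to \<open>(0, 1]\<close>
  by \<open>t \<mapsto> 1 / (t + 1)\<close>. The concatenation tends to \<open>x\<close> because the \<open>k\<close>-th path stays in the
  ball of radius \<open>1 / (k + 1)\<close>.
\<close>
lemma path_component_limit:
  fixes S :: "'a::metric_space set"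
  assumes q: "\<And>k. path_component (S \<inter> ball x (1 / real (Suc k))) (q k) (q (Suc k))" and "x \<in> S"
  shows "path_component S (q 0) x"
proof -
  have "\<forall>k. \<exists>p. path p \<and> path_image p \<subseteq> S \<inter> ball x (1 / real (Suc k)) \<and> pathstart p = q k \<and> pathfinish p = q (Suc k)"
    using q unfolding path_component_def by blast
  then obtain p where p: "\<And>k. path (p k)" "\<And>k. path_image (p k) \<subseteq> S \<inter> ball x (1 / real (Suc k))"
      "\<And>k. pathstart (p k) = q k" "\<And>k. pathfinish (p k) = q (Suc k)"
    by metis
  define g where "g = (\<lambda>t. p (nat \<lfloor>t\<rfloor>) (frac t))"
  define \<gamma> where "\<gamma> = (\<lambda>s. if s = 0 then x else g (1 / s - 1))"
  have g: "g t \<in> S \<inter> ball x (1 / real (Suc (nat \<lfloor>t\<rfloor>)))" for t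
  proof -
    have "g t \<in> path_image (p (nat \<lfloor>t\<rfloor>))"
      unfolding g_def path_image_def using frac_lt_1[of t] by (intro imageI) (auto simp: less_imp_le)
    then show ?thesis using p(2) by blast
  qed
  have "continuous_on {0..1} \<gamma>"
    unfolding continuous_on_eq_continuous_within
  proof
    fix s :: real assume s: "s \<in> {0..1}"
    show "continuous (at s within {0..1}) \<gamma>"
    proof (cases "s = 0")
      case True
      have "\<exists>d>0. \<forall>u\<in>{0..1}. dist u 0 < d \<longrightarrow> dist (\<gamma> u) (\<gamma> 0) < e" if e: "0 < e" for e
      proof -
        obtain N where N: "1 / real (Suc N) < e" using nat_approx_posE[OF e] by blast
        have "dist (\<gamma> u) x < e" if u: "u \<in> {0..1}" "u < 1 / real (Suc N)" for u
        proof (cases "u = 0")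
          case True
          then show ?thesis using \<open>0 < e\<close> by (simp add: \<gamma>_def)
        next
          case False
          then have "0 < u" using u by simp
          then have "u * real (Suc N) < 1" using u(2) by (simp add: field_simps)
          then have "real N \<le> 1 / u - 1" using \<open>0 < u\<close> by (simp add: field_simps)
          then have "N \<le> nat \<lfloor>1 / u - 1\<rfloor>" by (rule le_nat_floor)
          then have "1 / real (Suc (nat \<lfloor>1 / u - 1\<rfloor>)) \<le> 1 / real (Suc N)"
            by (intro divide_left_mono) auto
          moreover have "dist x (\<gamma> u) < 1 / real (Suc (nat \<lfloor>1 / u - 1\<rfloor>))"
            using g[of "1 / u - 1"] False by (simp add: \<gamma>_def)
          ultimately show ?thesis using N by (simp add: dist_commute)
        qed
        then show ?thesis
          by (intro exI[of _ "1 / real (Suc N)"]) (auto simp: \<gamma>_def dist_real_def)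
      qed
      then show ?thesis unfolding True continuous_within_eps_delta by blast
    next
      case False
      then have s0: "0 < s" using s by simp
      obtain n where n: "2 / s < real n" using reals_Archimedean2 by blast
      have "continuous_on {s / 2..1} (\<lambda>u. g (1 / u - 1))"
      proof (rule continuous_on_compose2[where g = g and t = "{0..real n}"])
        show "continuous_on {0..real n} g"
          unfolding g_def using p by (intro continuous_on_concatenated_paths) auto
        show "continuous_on {s / 2..1} (\<lambda>u. 1 / u - 1)"
          using s0 by (intro continuous_intros) auto
        show "(\<lambda>u. 1 / u - 1) ` {s / 2..1} \<subseteq> {0..real n}"
        proof (rule image_subsetI)
          fix u assume u: "u \<in> {s / 2..1}"
          then have "1 / u \<le> 2 / s" "1 \<le> 1 / u" using s0 by (auto simp: field_simps)
          then show "1 / u - 1 \<in> {0..real n}" using n by simp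
        qed
      qed
      then have "continuous_on {s / 2..1} \<gamma>"
        by (rule continuous_on_eq) (use s0 in \<open>auto simp: \<gamma>_def\<close>)
      then have "continuous (at s within {s / 2..1}) \<gamma>"
        using s s0 by (auto simp: continuous_on_eq_continuous_within)
      moreover have "at s within {s / 2..1} = at s within {0..1}"
        by (rule at_within_nhd[of s "{s / 2<..}"]) (use s0 in auto)
      ultimately show ?thesis by simp
    qed
  qed
  then have "path \<gamma>" by (simp add: path_def)
  moreover have "path_image \<gamma> \<subseteq> S"
    using g \<open>x \<in> S\<close> by (auto simp: path_image_def \<gamma>_def)
  moreover have "pathstart \<gamma> = x" "pathfinish \<gamma> = q 0"
    using p(3)[of 0] by (auto simp: pathstart_def pathfinish_def \<gamma>_def g_def)
  ultimately have "path_component S x (q 0)" unfolding path_component_def by blast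
  then show ?thesis by (rule path_component_sym)
qed

lemma closure_Union_finite: "finite F \<Longrightarrow> closure (\<Union>F) = \<Union>(closure ` F)"
  by (induction F rule: finite_induct) simp_all

text \<open>
  Near \<open>x\<close> the set \<open>T\<close> is covered by finitely many path-connected pieces of \<open>S\<close>, so \<open>x\<close> is a limit of its
  intersection with one of them.
\<close>
lemma closure_meets_local_path_component:
  fixes S :: "'a::metric_space set"
  assumes fpc: "finitely_path_connected (S \<inter> ball x r)" and "0 < r" "x \<in> closure T" "T \<subseteq> S"
  shows "\<exists>q\<in>T \<inter> ball x r. x \<in> closure (path_component_set (S \<inter> ball x r) q)"
proof -
  obtain F where F: "finite F" "\<And>C. C \<in> F \<Longrightarrow> path_connected C" "S \<inter> ball x r = \<Union>F"
    using finitely_path_connectedE[OF fpc] by metis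
  have "x \<in> ball x r \<inter> closure T" using assms(2,3) by simp
  moreover have "ball x r \<inter> closure T \<subseteq> closure (ball x r \<inter> T)"
    by (rule open_Int_closure_subset) simp
  moreover have "ball x r \<inter> T = \<Union>((\<lambda>C. C \<inter> T) ` F)"
    using F(3) assms(4) by blast
  ultimately have "x \<in> closure (\<Union>((\<lambda>C. C \<inter> T) ` F))" by auto
  then have "x \<in> (\<Union>C\<in>F. closure (C \<inter> T))"
    using F(1) closure_Union_finite[of "(\<lambda>C. C \<inter> T) ` F"] by simp
  then obtain C where C: "C \<in> F" "x \<in> closure (C \<inter> T)" by blast
  then obtain q where q: "q \<in> C" "q \<in> T" by (metis Int_iff all_not_in_conv closure_empty)
  have "C \<subseteq> path_component_set (S \<inter> ball x r) q"
    using C(1) q(1) F by (intro path_component_maximal) auto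
  then have "x \<in> closure (path_component_set (S \<inter> ball x r) q)"
    using C(2) closure_mono[of "C \<inter> T" "path_component_set (S \<inter> ball x r) q"] by blast
  moreover have "q \<in> ball x r" using C(1) q(1) F(3) by blast
  ultimately show ?thesis using q(2) by blast
qed

text \<open>
  Points \<open>q\<^sub>k\<close> are chosen recursively so that \<open>x\<close> is a limit of the path component of \<open>q\<^sub>k\<close> in the
  part of \<open>S\<close> inside the ball of radius \<open>1 / (k + 1)\<close>, and \<open>q\<^sub>k\<^sub>+\<^sub>1\<close> lies in that component.
\<close>
lemma path_component_contains_limit_points:
  fixes S :: "'a::metric_space set"
  assumes fpc: "\<And>r. finitely_path_connected (S \<inter> ball x r)"
    and "x \<in> S" "x \<in> closure (path_component_set S p)"
  shows "path_component S p x"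
proof -
  let ?B = "\<lambda>k. S \<inter> ball x (1 / real (Suc k))"
  define P where "P = (\<lambda>k q. path_component S p q \<and> x \<in> closure (path_component_set (?B k) q))"
  define Q where "Q = (\<lambda>k q q'. path_component (?B k) q q')"
  have "\<exists>q. \<forall>k. P k (q k) \<and> Q k (q k) (q (Suc k))"
  proof (rule dependent_nat_choice)
    show "\<exists>q. P 0 q"
      using closure_meets_local_path_component[OF fpc, of "1 / real (Suc 0)" "path_component_set S p"]
        assms(3) path_component_subset[of S p] by (auto simp: P_def)
  next
    fix q k assume q: "P k q"
    let ?C = "path_component_set (?B k) q"
    have C: "?C \<subseteq> ?B k" by (rule path_component_subset)
    have "\<exists>q'\<in>?C \<inter> ball x (1 / real (Suc (Suc k))).
        x \<in> closure (path_component_set (?B (Suc k)) q')"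
      using q C by (intro closure_meets_local_path_component fpc) (auto simp: P_def)
    then obtain q' where q': "path_component (?B k) q q'"
        "x \<in> closure (path_component_set (?B (Suc k)) q')" by auto
    have "path_component S q q'"
      by (rule path_component_of_subset[OF _ q'(1)]) simp
    moreover have "path_component S p q" using q by (simp add: P_def)
    ultimately have "path_component S p q'" by (rule path_component_trans[rotated])
    then show "\<exists>q'. P (Suc k) q' \<and> Q k q q'" using q' by (auto simp: P_def Q_def)
  qed
  then obtain q where q: "\<And>k. P k (q k)" "\<And>k. Q k (q k) (q (Suc k))" by blast
  then have "path_component S (q 0) x"
    by (intro path_component_limit[where q = q] \<open>x \<in> S\<close>) (use q(2) in \<open>simp add: Q_def\<close>)
  moreover have "path_component S p (q 0)" using q(1)[of 0] by (simp add: P_def)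
  ultimately show ?thesis by (rule path_component_trans[rotated])
qed

text \<open>
  The path components are finitely many and closed in \<open>S\<close>, hence also open in \<open>S\<close>, and so a connected
  component cannot contain two of them.
\<close>
theorem components_finite_path_connected:
  fixes S :: "'a::metric_space set"
  assumes fpc: "finitely_path_connected S"
    and local: "\<And>x r. finitely_path_connected (S \<inter> ball x r)"
  shows "finite (components S) \<and> (\<forall>C\<in>components S. path_connected C)"
proof -
  define \<P> where "\<P> = path_component_set S ` S"
  obtain F where F: "finite F" "\<And>C. C \<in> F \<Longrightarrow> path_connected C" "S = \<Union>F"
    using finitely_path_connectedE[OF fpc] by metis
  have "\<P> \<subseteq> (\<lambda>D. path_component_set S (SOME d. d \<in> D)) ` F"
  proof
    fix P assume "P \<in> \<P>"
    then obtain q D where q: "P = path_component_set S q" "q \<in> D" "D \<in> F" using F(3) by (auto simp: \<P>_def)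
    have "(SOME d. d \<in> D) \<in> D" using q(2) by (rule someI)
    moreover have "D \<subseteq> path_component_set S q"
      using q F by (intro path_component_maximal) auto
    ultimately have "path_component S q (SOME d. d \<in> D)" by auto
    then have "P = path_component_set S (SOME d. d \<in> D)"
      using q(1) by (simp add: path_component_eq)
    then show "P \<in> (\<lambda>D. path_component_set S (SOME d. d \<in> D)) ` F" using q(3) by blast
  qed
  then have fin: "finite \<P>" using F(1) finite_surj by blast
  have closed: "S \<inter> closure P \<subseteq> P" if "P \<in> \<P>" for P
    using that path_component_contains_limit_points[OF local] by (auto simp: \<P>_def)
  have main: "C \<in> \<P>" if C: "C \<in> components S" for C
  proof -
    obtain p where p: "p \<in> C" "p \<in> S"
      using C in_components_nonempty in_components_subset by blast
    define P where "P = path_component_set S p"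
    have P: "P \<in> \<P>" "p \<in> P" using p by (auto simp: P_def \<P>_def path_component_refl)
    define R where "R = \<Union>(\<P> - {P})"
    have cover: "C \<subseteq> P \<union> R"
    proof
      fix y assume "y \<in> C"
      then have "y \<in> S" using C in_components_subset by blast
      then have "path_component_set S y \<in> \<P>" "y \<in> path_component_set S y"
        by (auto simp: \<P>_def path_component_refl)
      then show "y \<in> P \<union> R" unfolding R_def by blast
    qed
    have disj: "P \<inter> R = {}"
    proof -
      have "P' = P" if P': "P' \<in> \<P>" "z \<in> P'" "z \<in> P" for P' z
      proof -
        obtain q where q: "P' = path_component_set S q" using P'(1) by (auto simp: \<P>_def)
        have "path_component_set S q = path_component_set S z" "path_component_set S p = path_component_set S z"
          using P' q by (auto simp: P_def intro!: path_component_eq intro: path_component_sym)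
        then show ?thesis using q by (simp add: P_def)
      qed
      then show ?thesis unfolding R_def by blast
    qed
    have "closure R = \<Union>(closure ` (\<P> - {P}))"
      unfolding R_def using fin by (intro closure_Union_finite) simp
    then have clR: "S \<inter> closure R \<subseteq> R" using closed unfolding R_def by blast
    have clP: "S \<inter> closure P \<subseteq> P" using closed P(1) .
    have "C \<subseteq> closure P \<union> closure R" using cover closure_subset by blast
    moreover have "closure P \<inter> closure R \<inter> C = {}"
      using clP clR disj in_components_subset[OF C] by blast
    moreover have "closure P \<inter> C \<noteq> {}" using p(1) P(2) closure_subset by blast
    ultimately have "closure R \<inter> C = {}"
      using in_components_connected[OF C] closed_closure unfolding connected_closed by metis
    then have "C \<subseteq> P" using cover closure_subset[of R] by blast
    moreover have "P \<subseteq> C"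
    proof (rule components_maximal[OF C])
      show "connected P" unfolding P_def by (simp add: path_connected_imp_connected)
      show "P \<subseteq> S" unfolding P_def by (rule path_component_subset)
      show "C \<inter> P \<noteq> {}" using p(1) P(2) by blast
    qed
    ultimately show ?thesis using P(1) by simp
  qed
  show ?thesis
  proof
    show "finite (components S)" using main by (intro finite_subset[OF _ fin] subsetI)
    show "\<forall>C\<in>components S. path_connected C"
    proof
      fix C assume "C \<in> components S"
      then have "C \<in> \<P>" by (rule main)
      then obtain q where "C = path_component_set S q" unfolding \<P>_def by (rule imageE)
      then show "path_connected C" by simp
    qed
  qed
qed

section \<open>Semi-algebraic subsets of Euclidean space\<close>

lemma finitely_path_connected_image:
  assumes "finitely_path_connected S" "continuous_on S f"
  shows "finitely_path_connected (f ` S)"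
proof -
  obtain F where F: "finite F" "\<And>C. C \<in> F \<Longrightarrow> path_connected C" "S = \<Union>F"
    using finitely_path_connectedE[OF assms(1)] by metis
  have "path_connected (f ` C)" if "C \<in> F" for C
    using that F assms(2) by (intro path_connected_continuous_image continuous_on_subset[OF assms(2)]) auto
  then show ?thesis
    unfolding finitely_path_connected_def F(3) using F(1)
    by (intro exI[of _ "(`) f ` F"]) auto
qed

abbreviation poly_funs :: "((real ^ 'n) \<Rightarrow> real) set" where
  "poly_funs \<equiv> {f. real_polynomial_function f}"

lemma basic_semialgebraic_sign_determined:
  assumes "basic_semialgebraic S" shows "sign_determined poly_funs S"
proof -
  obtain E G where EG: "finite E" "finite G" "\<forall>f\<in>E. real_polynomial_function f"
      "\<forall>g\<in>G. real_polynomial_function g" "S = {x. (\<forall>f\<in>E. f x = 0) \<and> (\<forall>g\<in>G. g x < 0)}"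
    using assms unfolding basic_semialgebraic_def by blast
  have "S = (\<Inter>f\<in>E. {x. f x = 0}) \<inter> (\<Inter>g\<in>G. {x. g x < 0})"
    unfolding EG(5) by blast
  moreover have "sign_determined poly_funs {x. f x = 0}" if "f \<in> E" for f
    by (rule sign_determined_Collect[where P = "\<lambda>r. r = 0"]) (use EG that in \<open>auto simp: sgn_if split: if_splits\<close>)
  moreover have "sign_determined poly_funs {x. g x < 0}" if "g \<in> G" for g
    by (rule sign_determined_Collect[where P = "\<lambda>r. r < 0"]) (use EG that in \<open>auto simp: sgn_if split: if_splits\<close>)
  ultimately show ?thesis
    using EG(1,2) by (simp add: sign_determined_Int sign_determined_INT)
qed

text \<open>
  A basic set is a finite intersection of sign conditions. Conversely, a set determined by the signs of
  the functions in \<open>B\<close> is the union of the finitely many basic sets on which all these signs are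
  prescribed.
\<close>
lemma semialgebraic_iff_sign_determined:
  "semialgebraic S \<longleftrightarrow> sign_determined poly_funs S"
proof
  assume "semialgebraic S"
  then obtain \<B> where B: "finite \<B>" "\<forall>B\<in>\<B>. basic_semialgebraic B" "S = \<Union>\<B>"
    unfolding semialgebraic_def by blast
  then show "sign_determined poly_funs S"
    using sign_determined_UN[of \<B> poly_funs "\<lambda>B. B"] basic_semialgebraic_sign_determined by auto
next
  assume "sign_determined poly_funs S"
  then obtain B where B: "finite B" "B \<subseteq> poly_funs" "\<And>x y. same_signs B x y \<Longrightarrow> x \<in> S \<longleftrightarrow> y \<in> S"
    unfolding sign_determined_def by blast
  define Sgn where "Sgn = PiE B (\<lambda>_. {-1, 0, 1::real})"
  define cls where "cls = (\<lambda>\<sigma>. {x. \<forall>b\<in>B. sgn (b x) = \<sigma> b})"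
  have fin: "finite Sgn" using B(1) by (auto simp: Sgn_def intro!: finite_PiE)
  have basic: "basic_semialgebraic (cls \<sigma>)" if "\<sigma> \<in> Sgn" for \<sigma>
  proof -
    define E where "E = {b \<in> B. \<sigma> b = 0}"
    define G where "G = {b \<in> B. \<sigma> b = -1} \<union> (\<lambda>b x. - 1 * b x) ` {b \<in> B. \<sigma> b = 1}"
    have \<sigma>: "\<sigma> b = -1 \<or> \<sigma> b = 0 \<or> \<sigma> b = 1" if "b \<in> B" for b
      using PiE_mem[OF \<open>\<sigma> \<in> Sgn\<close>[unfolded Sgn_def] that] by auto
    have "x \<in> cls \<sigma> \<longleftrightarrow> (\<forall>f\<in>E. f x = 0) \<and> (\<forall>g\<in>G. g x < 0)" for x
    proof -
      have "(\<forall>f\<in>E. f x = 0) \<and> (\<forall>g\<in>G. g x < 0) \<longleftrightarrow>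
          (\<forall>b\<in>B. (\<sigma> b = 0 \<longrightarrow> b x = 0) \<and> (\<sigma> b = -1 \<longrightarrow> b x < 0) \<and> (\<sigma> b = 1 \<longrightarrow> b x > 0))"
        unfolding E_def G_def by (simp add: ball_Un) blast
      also have "\<dots> \<longleftrightarrow> (\<forall>b\<in>B. sgn (b x) = \<sigma> b)"
      proof (rule ball_cong[OF refl])
        fix b assume "b \<in> B"
        then show "((\<sigma> b = 0 \<longrightarrow> b x = 0) \<and> (\<sigma> b = -1 \<longrightarrow> b x < 0) \<and> (\<sigma> b = 1 \<longrightarrow> b x > 0)) = (sgn (b x) = \<sigma> b)"
          using \<sigma>[of b] by (auto simp: sgn_if)
      qed
      finally show ?thesis by (simp add: cls_def)
    qed
    then have "cls \<sigma> = {x. (\<forall>f\<in>E. f x = 0) \<and> (\<forall>g\<in>G. g x < 0)}" by blast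
    moreover have "finite E" "finite G" "\<forall>f\<in>E. real_polynomial_function f"
      using B by (auto simp: E_def G_def)
    moreover have "\<forall>g\<in>G. real_polynomial_function g"
      using B(2) by (auto simp: G_def simp del: mult_minus1)
    ultimately show ?thesis unfolding basic_semialgebraic_def by blast
  qed
  have "S = \<Union>(cls ` {\<sigma> \<in> Sgn. cls \<sigma> \<subseteq> S})"
  proof (intro equalityI subsetI)
    fix x assume x: "x \<in> S"
    define \<sigma> where "\<sigma> = restrict (\<lambda>b. sgn (b x)) B"
    have "\<sigma> \<in> Sgn" "x \<in> cls \<sigma>" by (auto simp: \<sigma>_def Sgn_def cls_def sgn_if)
    moreover have "cls \<sigma> \<subseteq> S"
    proof
      fix y assume "y \<in> cls \<sigma>"
      then have "same_signs B x y" by (simp add: cls_def \<sigma>_def same_signs_def)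
      then show "y \<in> S" using B(3) x by blast
    qed
    ultimately show "x \<in> \<Union>(cls ` {\<sigma> \<in> Sgn. cls \<sigma> \<subseteq> S})" by blast
  qed auto
  then show "semialgebraic S"
    unfolding semialgebraic_def using fin basic by (intro exI[of _ "cls ` {\<sigma> \<in> Sgn. cls \<sigma> \<subseteq> S}"]) auto
qed

definition vec_of :: "('n \<Rightarrow> nat) \<Rightarrow> (nat \<Rightarrow> real) \<Rightarrow> real ^ 'n" where
  "vec_of c z = (\<chi> i. z (c i))"

lemma poly_fun_vec_of:
  fixes f :: "real ^ 'n \<Rightarrow> real"
  assumes "real_polynomial_function f" "\<And>i. c i < N"
  shows "(\<lambda>z. f (vec_of c z)) \<in> coord_polys N"
  using assms(1)
proof (induction rule: real_polynomial_function.induct)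
  case (linear f)
  have f: "f v = (\<Sum>i\<in>UNIV. f (axis i 1) * v $ i)" for v
  proof -
    have "f v = f (\<Sum>i\<in>UNIV. (v $ i) *\<^sub>R axis i 1)"
      by (simp add: basis_expansion scalar_mult_eq_scaleR[symmetric])
    also have "\<dots> = (\<Sum>i\<in>UNIV. f (axis i 1) * v $ i)"
      using linear by (simp add: linear_sum linear_scale bounded_linear.linear mult.commute)
    finally show ?thesis .
  qed
  have "(\<lambda>z. f (vec_of c z)) = (\<lambda>z. \<Sum>i\<in>UNIV. f (axis i 1) * z (c i))"
    by (rule ext, subst f) (simp add: vec_of_def)
  also have "\<dots> \<in> coord_polys N"
    using assms(2) by (auto intro!: coord_polys_sum coord_polys.intros)
  finally show ?case .
qed (rule coord_polys.intros; assumption)+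

lemma coord_poly_of_vec:
  "f \<in> coord_polys N \<Longrightarrow> real_polynomial_function (\<lambda>v. f (\<lambda>k. v $ d k))"
proof (induction rule: coord_polys.induct)
  case (coord i)
  show ?case by (intro real_polynomial_function.intros(1) bounded_linear_vec_nth)
qed (rule real_polynomial_function.intros; assumption)+

text \<open>
  The transfer between vectors and sequences: \<open>c\<close> numbers the coordinates, \<open>d\<close> inverts it, and \<open>N\<close> bounds the
  numbers.
\<close>
lemma coordinate_numbering:
  obtains c :: "'n::finite \<Rightarrow> nat" and N d where "\<And>i. c i < N" "\<And>i. d (c i) = i"
proof -
  obtain c :: "'n \<Rightarrow> nat" and N where "c ` UNIV = {i. i < N}" "inj_on c UNIV"
    using finite_imp_inj_to_nat_seg[of "UNIV :: 'n set"] by auto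
  then show thesis using that[of c N "inv c"] by auto
qed

lemma semialgebraic_finitely_path_connected:
  fixes S :: "(real ^ 'n) set"
  assumes "semialgebraic S" shows "finitely_path_connected S"
proof -
  obtain c :: "'n \<Rightarrow> nat" and N d where c: "\<And>i. c i < N" "\<And>i. d (c i) = i"
    using coordinate_numbering by metis
  have "sign_determined (coord_polys N) (vec_of c -` S)"
    using assms c(1) unfolding semialgebraic_iff_sign_determined
    by (intro sign_determined_vimage[of poly_funs S]) (auto intro: poly_fun_vec_of)
  then have "finitely_path_connected (vec_of c -` S)"
    by (rule sign_determined_finitely_path_connected)
  moreover have "continuous_on (vec_of c -` S) (vec_of c)"
    unfolding vec_of_def
    by (intro continuous_on_vec_lambda continuous_on_subset[OF continuous_on_product_coordinates]) auto
  ultimately have "finitely_path_connected (vec_of c ` (vec_of c -` S))"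
    by (rule finitely_path_connected_image)
  moreover have "vec_of c (\<lambda>k. v $ d k) = v" for v by (simp add: vec_of_def c(2))
  then have "vec_of c ` (vec_of c -` S) = S" by (metis surj_def surj_image_vimage_eq)
  ultimately show ?thesis by simp
qed

lemma semialgebraic_ball: "semialgebraic (ball x r)" for x :: "real ^ 'n"
proof (cases "0 < r")
  case True
  define b where "b = (\<lambda>v. (\<Sum>i\<in>UNIV. (v $ i + - (x $ i)) * (v $ i + - (x $ i))) + - (r\<^sup>2))"
  have poly: "real_polynomial_function b"
    unfolding b_def by (intro real_polynomial_function.intros(2-4) real_polynomial_function_sum
        real_polynomial_function.intros(1)[OF bounded_linear_vec_nth]) auto
  have "v \<in> ball x r \<longleftrightarrow> b v < 0" for v
  proof -
    have "v \<in> ball x r \<longleftrightarrow> norm (v - x) < r" by (simp add: dist_norm norm_minus_commute)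
    also have "\<dots> \<longleftrightarrow> inner (v - x) (v - x) < r\<^sup>2" using True by (simp add: norm_lt_square)
    finally show ?thesis by (simp add: b_def inner_vec_def)
  qed
  then have "ball x r = {v. b v < 0}" by blast
  then have "basic_semialgebraic (ball x r)"
    unfolding basic_semialgebraic_def using poly
    by (intro exI[of _ "{}"] exI[of _ "{b}"]) simp
  then show ?thesis unfolding semialgebraic_def by (intro exI[of _ "{ball x r}"]) auto
next
  case False
  then have "ball x r = {}" by simp
  then show ?thesis unfolding semialgebraic_def by (intro exI[of _ "{}"]) auto
qed

theorem semialgebraic_components:
  fixes S :: "(real ^ 'n) set"
  assumes "semialgebraic S"
  shows "finite (components S) \<and> (\<forall>C\<in>components S. path_connected C)"
proof (rule components_finite_path_connected)
  show "finitely_path_connected S" using assms by (rule semialgebraic_finitely_path_connected)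
  show "finitely_path_connected (S \<inter> ball x r)" for x r
    using assms semialgebraic_ball[of x r]
    by (intro semialgebraic_finitely_path_connected)
      (simp add: semialgebraic_iff_sign_determined sign_determined_Int)
qed

text \<open>
  The pair \<open>(x, y)\<close> is encoded by a sequence with \<open>x\<close> in the coordinates below \<open>N\<close> and \<open>y\<close> in the next \<open>N\<close>, and
  the latter are projected away.
\<close>
lemma semialgebraic_exists:
  fixes R :: "real ^ 'n \<Rightarrow> real ^ 'n \<Rightarrow> bool"
  assumes c: "\<And>i. c i < N" "\<And>i. d (c i) = i"
    and R: "sign_determined (coord_polys (N + N)) {z. R (vec_of c z) (vec_of (\<lambda>i. N + c i) z)}"
  shows "semialgebraic {x. \<exists>y. R x y}"
proof -
  let ?T = "{z. R (vec_of c z) (vec_of (\<lambda>i. N + c i) z)}"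
  have "sign_determined poly_funs ((\<lambda>v k. v $ d k) -` {x. \<exists>z\<in>?T. \<forall>i<N. z i = x i})"
    by (rule sign_determined_vimage[OF sign_determined_projections[OF R]])
      (simp add: coord_poly_of_vec)
  moreover have "(\<lambda>v k. v $ d k) -` {x. \<exists>z\<in>?T. \<forall>i<N. z i = x i} = {x. \<exists>y. R x y}"
  proof (intro equalityI subsetI)
    fix v assume "v \<in> (\<lambda>v k. v $ d k) -` {x. \<exists>z\<in>?T. \<forall>i<N. z i = x i}"
    then obtain z where z: "z \<in> ?T" "\<forall>i<N. z i = v $ d i" by auto
    then have "vec_of c z = v" by (simp add: vec_of_def c vec_eq_iff)
    then show "v \<in> {x. \<exists>y. R x y}" using z(1) by auto
  next
    fix v assume "v \<in> {x. \<exists>y. R x y}"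
    then obtain y where y: "R v y" by blast
    define z where "z = (\<lambda>k. if k < N then v $ d k else y $ d (k - N))"
    have "vec_of c z = v" "vec_of (\<lambda>i. N + c i) z = y"
      by (simp_all add: vec_of_def z_def c vec_eq_iff)
    then show "v \<in> (\<lambda>v k. v $ d k) -` {x. \<exists>z\<in>?T. \<forall>i<N. z i = x i}"
      using y by (auto intro!: exI[of _ z] simp: z_def)
  qed
  ultimately show ?thesis by (simp add: semialgebraic_iff_sign_determined)
qed

section \<open>Solution sets of polynomial vector variational inequalities\<close>

lemma interior_nonneg_orthant:
  "interior (nonneg_orthant :: (real ^ 'm) set) = {v. \<forall>l. 0 < v $ l}"
proof (intro equalityI subsetI)
  fix v :: "real ^ 'm" assume v: "v \<in> interior nonneg_orthant"
  have "0 < v $ l" for l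
  proof -
    have "(nonneg_orthant :: (real ^ 'm) set) \<subseteq> {x. x $ l \<ge> 0}" by (auto simp: nonneg_orthant_def)
    from interior_mono[OF this] v show ?thesis by auto
  qed
  then show "v \<in> {v. \<forall>l. 0 < v $ l}" by simp
next
  have "{v :: real ^ 'm. \<forall>l. 0 < v $ l} = (\<Inter>l. {v. v $ l > 0})" by auto
  also have "open \<dots>" by (intro open_INT ballI open_Collect_less continuous_intros) auto
  finally have "{v :: real ^ 'm. \<forall>l. 0 < v $ l} \<subseteq> interior nonneg_orthant"
    by (intro interior_maximal) (auto simp: nonneg_orthant_def less_imp_le)
  then show "v \<in> interior nonneg_orthant" if "v \<in> {v. \<forall>l. 0 < v $ l}" for v :: "real ^ 'm"
    using that by blast
qed

text \<open>
  The points of \<open>K\<close> that are not solutions form a projection of a semi-algebraic set of pairs. On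
  \<open>K\<close> the maps may be replaced by polynomials \<open>p\<close>.
\<close>
lemma vvi_semialgebraic:
  fixes K :: "(real ^ 'n) set" and F :: "'m::finite \<Rightarrow> real ^ 'n \<Rightarrow> real ^ 'n"
  assumes K: "semialgebraic K" and F: "\<forall>l. polynomial_map_on K (F l)"
  shows "semialgebraic (Solw_PVVI F K)" "semialgebraic (Sol_PVVI F K)"
proof -
  have "\<forall>l j. \<exists>p. real_polynomial_function p \<and> (\<forall>x\<in>K. F l x $ j = p x)"
    using F unfolding polynomial_map_on_def by blast
  then obtain p where p: "\<And>l j. real_polynomial_function (p l j)" "\<And>l j x. x \<in> K \<Longrightarrow> F l x $ j = p l j x"
    by metis
  define G where "G = (\<lambda>l x y. \<Sum>j\<in>UNIV. p l j x * (y $ j - x $ j))"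
  have vvi: "vvi_map F x (y - x) $ l = G l x y" if "x \<in> K" for x y l
    using that by (simp add: vvi_map_def G_def inner_vec_def p(2))
  obtain c :: "'n \<Rightarrow> nat" and N d where c: "\<And>i. c i < N" "\<And>i. d (c i) = i"
    using coordinate_numbering by metis
  let ?P = "coord_polys (N + N)"
  let ?x = "vec_of c" and ?y = "vec_of (\<lambda>i. N + c i)"
  have ring: "function_ring ?P" by (rule function_ring_coord_polys)
  have cN: "c i < N + N" "N + c i < N + N" for i using c(1)[of i] by auto
  have Gp: "(\<lambda>z. G l (?x z) (?y z)) \<in> ?P" for l
  proof -
    have "(\<lambda>z. p l j (?x z) * (?y z $ j - ?x z $ j)) \<in> ?P" for j
    proof -
      have "(\<lambda>z. ?y z $ j) \<in> ?P" "(\<lambda>z. ?x z $ j) \<in> ?P"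
        using cN by (auto simp: vec_of_def intro: coord_polys.intros)
      moreover have "(\<lambda>z. p l j (?x z)) \<in> ?P" using p(1) cN(1) by (rule poly_fun_vec_of)
      ultimately show ?thesis by (intro function_ringD[OF ring])
    qed
    then show ?thesis unfolding G_def by (intro coord_polys_sum) auto
  qed
  have KK: "sign_determined ?P (?x -` K \<inter> ?y -` K)"
  proof (rule sign_determined_Int)
    show "sign_determined ?P (?x -` K)" "sign_determined ?P (?y -` K)"
      using K unfolding semialgebraic_iff_sign_determined
      by (rule sign_determined_vimage, simp add: poly_fun_vec_of cN c(1))+
  qed
  have neg: "sign_determined ?P {z. G l (?x z) (?y z) < 0}" for l
    by (rule sign_determined_Collect[where P = "\<lambda>r. r < 0", OF Gp]) (auto simp: sgn_if split: if_splits)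
  have nonpos: "sign_determined ?P {z. G l (?x z) (?y z) \<le> 0}" for l
    by (rule sign_determined_Collect[where P = "\<lambda>r. r \<le> 0", OF Gp]) (auto simp: sgn_if split: if_splits)
  have weak: "semialgebraic {x. \<exists>y. x \<in> K \<and> y \<in> K \<and> (\<forall>l. G l x y < 0)}" (is "semialgebraic ?W")
  proof (rule semialgebraic_exists[OF c])
    have "{z. ?x z \<in> K \<and> ?y z \<in> K \<and> (\<forall>l. G l (?x z) (?y z) < 0)} =
        (?x -` K \<inter> ?y -` K) \<inter> (\<Inter>l. {z. G l (?x z) (?y z) < 0})" by blast
    then show "sign_determined ?P {z. ?x z \<in> K \<and> ?y z \<in> K \<and> (\<forall>l. G l (?x z) (?y z) < 0)}"
      using KK neg by (simp add: sign_determined_Int sign_determined_INT)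
  qed
  have strong: "semialgebraic {x. \<exists>y. x \<in> K \<and> y \<in> K \<and> (\<forall>l. G l x y \<le> 0) \<and> (\<exists>l. G l x y < 0)}"
    (is "semialgebraic ?S")
  proof (rule semialgebraic_exists[OF c])
    have "{z. ?x z \<in> K \<and> ?y z \<in> K \<and> (\<forall>l. G l (?x z) (?y z) \<le> 0) \<and> (\<exists>l. G l (?x z) (?y z) < 0)} =
        (?x -` K \<inter> ?y -` K) \<inter> ((\<Inter>l. {z. G l (?x z) (?y z) \<le> 0}) \<inter> (\<Union>l. {z. G l (?x z) (?y z) < 0}))"
      by blast
    then show "sign_determined ?P
        {z. ?x z \<in> K \<and> ?y z \<in> K \<and> (\<forall>l. G l (?x z) (?y z) \<le> 0) \<and> (\<exists>l. G l (?x z) (?y z) < 0)}"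
      using KK neg nonpos by (simp add: sign_determined_Int sign_determined_INT sign_determined_UN)
  qed
  have "Solw_PVVI F K = K - ?W"
    by (auto simp: Solw_PVVI_def interior_nonneg_orthant vvi)
  then show "semialgebraic (Solw_PVVI F K)"
    using K weak by (simp add: semialgebraic_iff_sign_determined sign_determined_Diff)
  have dominates: "- vvi_map F x (y - x) \<in> nonneg_orthant - {0} \<longleftrightarrow> (\<forall>l. G l x y \<le> 0) \<and> (\<exists>l. G l x y < 0)"
    if "x \<in> K" for x y
    using vvi[OF that] by (auto simp: nonneg_orthant_def vec_eq_iff less_le)
  have "Sol_PVVI F K = {x \<in> K. \<forall>y\<in>K. \<not> ((\<forall>l. G l x y \<le> 0) \<and> (\<exists>l. G l x y < 0))}"
    unfolding Sol_PVVI_def by (intro Collect_cong conj_cong ball_cong refl) (simp only: dominates)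
  also have "\<dots> = K - ?S" by blast
  finally have "Sol_PVVI F K = K - ?S" .
  then show "semialgebraic (Sol_PVVI F K)"
    using K strong by (simp add: semialgebraic_iff_sign_determined sign_determined_Diff)
qed

theorem theorem3p1:
  fixes K :: "(real ^ 'n::finite) set"
    and F :: "'m::finite \<Rightarrow> real ^ 'n \<Rightarrow> real ^ 'n"
  assumes "K \<noteq> {}"
    and "semialgebraic K"
    and "\<forall>l. polynomial_map_on K (F l)"
  shows "semialgebraic (Solw_PVVI F K) \<and> semialgebraic (Sol_PVVI F K) \<and>
    finite (components (Solw_PVVI F K)) \<and> (\<forall>C\<in>components (Solw_PVVI F K). path_connected C) \<and>
    finite (components (Sol_PVVI F K)) \<and> (\<forall>C\<in>components (Sol_PVVI F K). path_connected C)"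
  using vvi_semialgebraic[OF assms(2,3)] semialgebraic_components by blast

end
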